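(* There exists an absolute constant $C>0$ such that the following holds. Let $\varepsilon\in(0,1/4)$, let $t\geq 1$ be an integer, and let $n\geq 2^{t\cdot 2^{C(\log(1/\varepsilon))^8}}$. Let $G$ be a $2$-edge-coloured (red/blue) complete graph $K_n$ which is locally $(1/4+\varepsilon)$-balanced. Then $G$ contains two disjoint vertex sets $A,B$ with $|A|=|B|=t$ such that, for some colour $c\in\{\text{red},\text{blue}\}$, all edges inside $A$ and all edges inside $B$ have colour $c$ and all edges between $A$ and $B$ have the other colour. (Equivalently, $G$ contains a complete subgraph on $2t$ vertices in which one colour class forms exactly a $K_{t,t}$.)
   Context: A $2$-edge-coloured $K_n$ is called locally $\gamma$-balanced if every vertex is incident to at least $\gamma n$ red edges and at least $\gamma n$ blue edges. *)

theory Defs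
  imports Complex_Main
begin

text \<open>A 2-edge-colouring of K_n on vertex set {..<n}: col u v = True means the edge uv is red,
  False means blue. Only values on pairs of distinct vertices matter; the colouring must be symmetric.\<close>

definition two_colouring :: "nat \<Rightarrow> (nat \<Rightarrow> nat \<Rightarrow> bool) \<Rightarrow> bool" where
  "two_colouring n col \<longleftrightarrow> (\<forall>u<n. \<forall>v<n. u \<noteq> v \<longrightarrow> col u v = col v u)"

definition locally_balanced :: "nat \<Rightarrow> (nat \<Rightarrow> nat \<Rightarrow> bool) \<Rightarrow> real \<Rightarrow> bool" where
  "locally_balanced n col \<gamma> \<longleftrightarrow>
     (\<forall>v<n. real (card {u. u < n \<and> u \<noteq> v \<and> col v u}) \<ge> \<gamma> * n
          \<and> real (card {u. u < n \<and> u \<noteq> v \<and> \<not> col v u}) \<ge> \<gamma> * n)"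

end

theory Submission
  imports Defs "HOL-Library.FuncSet"
begin

text \<open>Call a coloured set split if it is the union of a red clique and a blue clique. In a split colouring
  of \<open>K\<^sub>k\<close> with parts \<open>R\<close> and \<open>B\<close>, the blue edges at \<open>R\<close> and the red edges at \<open>B\<close> all run between
  \<open>R\<close> and \<open>B\<close>, so local \<open>\<gamma>\<close>-balance forces \<open>\<gamma> k\<^sup>2 \<le> |R| |B| \<le> k\<^sup>2/4\<close> up to lower-order terms.
  Hence most samples of \<open>k \<approx> 16/\<epsilon>\<^sup>2\<close> vertices are not split (a second moment
  computation), and by the theorem of Foldes and Hammer each of them contains five vertices that are not
  split. So a polynomial (in \<open>\<epsilon>\<close>) proportion of all 5-tuples carry the same non-split pattern.
  An induction on the number of parts in the style of Nikiforov turns this into a blow-up of the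
  pattern with monochromatic parts of size proportional to \<open>log n\<close>. As the pattern is not split, some two
  parts of the same colour are joined in the other colour.\<close>

text \<open>A single set \<open>R\<close> encodes the partition: \<open>S \<inter> R\<close> is the red clique, \<open>S - R\<close> the blue one.\<close>
definition splits :: "('a \<Rightarrow> 'a \<Rightarrow> bool) \<Rightarrow> 'a set \<Rightarrow> 'a set \<Rightarrow> bool" where
  "splits E S R \<longleftrightarrow> (\<forall>u\<in>S. \<forall>v\<in>S. u \<noteq> v \<longrightarrow>
     (u \<in> R \<and> v \<in> R \<longrightarrow> E u v) \<and> (u \<notin> R \<and> v \<notin> R \<longrightarrow> \<not> E u v))"

definition mono_set :: "('a \<Rightarrow> 'a \<Rightarrow> bool) \<Rightarrow> bool \<Rightarrow> 'a set \<Rightarrow> bool" where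
  "mono_set E c S \<longleftrightarrow> (\<forall>u\<in>S. \<forall>v\<in>S. u \<noteq> v \<longrightarrow> E u v = c)"

section \<open>Split sets and their forbidden configurations\<close>

lemma splits_mono: "splits E S R \<Longrightarrow> T \<subseteq> S \<Longrightarrow> splits E T R"
  unfolding splits_def by blast

lemma splits_red: "splits E S R \<Longrightarrow> u \<in> S \<Longrightarrow> v \<in> S \<Longrightarrow> u \<noteq> v \<Longrightarrow> u \<in> R \<Longrightarrow> v \<in> R \<Longrightarrow> E u v"
  and splits_blue: "splits E S R \<Longrightarrow> u \<in> S \<Longrightarrow> v \<in> S \<Longrightarrow> u \<noteq> v \<Longrightarrow> u \<notin> R \<Longrightarrow> v \<notin> R \<Longrightarrow> \<not> E u v"
  unfolding splits_def by blast+

text \<open>The red pairs form a 5-cycle and the blue pairs do too. A monochromatic set of either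
  colour has at most two vertices, so two of them cannot cover all five.\<close>

lemma not_splits_5_cycle:
  assumes "E a b" "E b c" "E c d" "E d e" "E e a"
    and "\<not> E a c" "\<not> E b d" "\<not> E c e" "\<not> E d a" "\<not> E e b"
    and "distinct [a, b, c, d, e]"
  shows "\<not> splits E {a, b, c, d, e} R"
  using assms unfolding splits_def by auto

text \<open>\<open>R\<close> misses one of \<open>a\<close>, \<open>c\<close> and one of
  \<open>b\<close>, \<open>d\<close>, since these pairs are blue; the two missed vertices are joined
  in red.\<close>

lemma not_splits_4_cycle:
  assumes "E a b" "E b c" "E c d" "E d a" "\<not> E a c" "\<not> E b d" "distinct [a, b, c, d]"
  shows "\<not> splits E {a, b, c, d} R"
  using assms unfolding splits_def by auto

text \<open>The 4-cycle obstruction with the colours exchanged: \<open>R\<close> meets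
  \<open>{a, b}\<close> and \<open>{c, d}\<close>, and the two vertices met are joined in
  blue.\<close>

lemma not_splits_two_edges:
  assumes "E a b" "E c d" "\<not> E a c" "\<not> E a d" "\<not> E b c" "\<not> E b d" "distinct [a, b, c, d]"
  shows "\<not> splits E {a, b, c, d} R"
  using assms unfolding splits_def by auto

section \<open>Ramsey's theorem for two colours\<close>

text \<open>Erdos-Szekeres halving: at least \<open>2 * 2 ^ s - 1\<close> vertices remain after
  removing \<open>v\<close>, so one colour neighbourhood of \<open>v\<close> has at least
  \<open>2 ^ s\<close> of them, and \<open>v\<close> can be added to any clique of that colour found
  there.\<close>

lemma ramsey_power2:
  assumes "finite X" "card X \<ge> 2 ^ (a + b)"
    and "\<And>u v. u \<in> X \<Longrightarrow> v \<in> X \<Longrightarrow> u \<noteq> v \<Longrightarrow> E u v = E v u"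
  shows "(\<exists>K\<subseteq>X. card K = a \<and> mono_set E True K) \<or> (\<exists>K\<subseteq>X. card K = b \<and> mono_set E False K)"
  using assms
proof (induction "a + b" arbitrary: a b X)
  case 0
  then show ?case by (intro disjI1 exI[of _ "{}"]) (auto simp: mono_set_def)
next
  case (Suc s)
  show ?case
  proof (cases "a = 0 \<or> b = 0")
    case True
    then show ?thesis by (metis card.empty empty_iff empty_subsetI mono_set_def)
  next
    case False
    then obtain a' b' where ab: "a = Suc a'" "b = Suc b'" by (meson not0_implies_Suc)
    have "card X > 0" using Suc.prems(2) by (metis less_le_trans zero_less_numeral zero_less_power)
    then obtain v where v: "v \<in> X" by fastforce
    define P where "P c = {u \<in> X - {v}. E v u = c}" for c
    have fin: "finite (P c)" for c using Suc.prems(1) by (simp add: P_def)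
    have "card (P True) + card (P False) = card (X - {v})"
      using Suc.prems(1) by (subst card_Un_disjoint[symmetric]) (auto simp: P_def intro!: arg_cong[of _ _ card])
    also have "Suc \<dots> \<ge> 2 * 2 ^ s"
      using Suc.prems(1,2) Suc.hyps(2) v by (metis card_Suc_Diff1 power_Suc)
    finally have "card (P True) \<ge> 2 ^ s \<or> card (P False) \<ge> 2 ^ s" by linarith
    moreover have extend: "\<exists>K'\<subseteq>X. card K' = Suc m \<and> mono_set E c K'"
      if "K \<subseteq> P c" "card K = m" "mono_set E c K" for K m c
    proof (intro exI conjI)
      have "finite K" using that(1) fin finite_subset by blast
      moreover have "v \<notin> K" using that(1) by (auto simp: P_def)
      ultimately show "card (insert v K) = Suc m" using that(2) by simp
      show "insert v K \<subseteq> X" using that(1) v by (auto simp: P_def)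
      show "mono_set E c (insert v K)"
        using that(1,3) v Suc.prems(3) unfolding mono_set_def P_def by blast
    qed
    have lift: "\<exists>K'\<subseteq>X. card K' = m \<and> mono_set E c' K'"
      if "K \<subseteq> P c" "card K = m" "mono_set E c' K" for K m c c'
      using that by (auto simp: P_def)
    have sym: "E u w = E w u" if "u \<in> P c" "w \<in> P c" "u \<noteq> w" for u w c
      using that Suc.prems(3) by (auto simp: P_def)
    ultimately show ?thesis
    proof (elim disjE)
      assume *: "2 ^ s \<le> card (P True)"
      have "s = a' + b" using Suc.hyps(2) ab by simp
      from Suc.hyps(1)[OF this fin[of True]] * this sym
      have "(\<exists>K\<subseteq>P True. card K = a' \<and> mono_set E True K) \<or> (\<exists>K\<subseteq>P True. card K = b \<and> mono_set E False K)"
        by metis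
      then show ?thesis using extend lift ab by metis
    next
      assume *: "2 ^ s \<le> card (P False)"
      have "s = a + b'" using Suc.hyps(2) ab by simp
      from Suc.hyps(1)[OF this fin[of False]] * this sym
      have "(\<exists>K\<subseteq>P False. card K = a \<and> mono_set E True K) \<or> (\<exists>K\<subseteq>P False. card K = b' \<and> mono_set E False K)"
        by metis
      then show ?thesis using extend lift ab by metis
    qed
  qed
qed

section \<open>The theorem of Foldes and Hammer\<close>

lemma finite_ex_max:
  fixes f :: "'a \<Rightarrow> 'b::linorder"
  assumes "finite A" "A \<noteq> {}"
  shows "\<exists>x\<in>A. \<forall>y\<in>A. f y \<le> f x"
proof -
  have "Max (f ` A) \<in> f ` A" using assms by (intro Max_in) auto
  then obtain x where x: "x \<in> A" "f x = Max (f ` A)" by auto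
  have "f y \<le> f x" if "y \<in> A" for y unfolding x(2) using assms that by (intro Max_ge) auto
  then show ?thesis using x(1) by blast
qed

text \<open>A red clique of maximum size, and with maximum degree sum among those, has a blue complement:
  the obstructions met on the way are \<open>2K\<^sub>2\<close>, \<open>C\<^sub>4\<close> and \<open>C\<^sub>5\<close>.\<close>
lemma foldes_hammer:
  assumes fin: "finite S" and sym: "\<And>u v. u \<in> S \<Longrightarrow> v \<in> S \<Longrightarrow> u \<noteq> v \<Longrightarrow> E u v = E v u"
    and small: "\<And>T. T \<subseteq> S \<Longrightarrow> card T \<le> 5 \<Longrightarrow> \<exists>R. splits E T R"
  shows "\<exists>R. splits E S R"
proof -
  define d where "d v = card {u \<in> S. u \<noteq> v \<and> E v u}" for v
  define Q where "Q = {K. K \<subseteq> S \<and> mono_set E True K}"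
  have finQ: "finite Q" and "{} \<in> Q" using fin by (auto simp: Q_def mono_set_def)
  obtain K0 where K0: "K0 \<in> Q" "\<And>K. K \<in> Q \<Longrightarrow> card K \<le> card K0"
    using finite_ex_max[of Q card] finQ \<open>{} \<in> Q\<close> by blast
  define Q' where "Q' = {K \<in> Q. card K = card K0}"
  have "finite Q'" "K0 \<in> Q'" using finQ K0 by (auto simp: Q'_def)
  then obtain K where K: "K \<in> Q'" "\<And>K'. K' \<in> Q' \<Longrightarrow> sum d K' \<le> sum d K"
    using finite_ex_max[of Q' "sum d"] by blast
  have KS: "K \<subseteq> S" and Kred: "mono_set E True K" using K(1) by (auto simp: Q'_def Q_def)
  have Kfin: "finite K" using KS fin finite_subset by blast
  have Kmax: "card K' \<le> card K" if "K' \<subseteq> S" "mono_set E True K'" for K'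
    using K0(2)[of K'] K(1) that by (auto simp: Q'_def Q_def)
  have Kdeg: "sum d K' \<le> sum d K" if "K' \<subseteq> S" "mono_set E True K'" "card K' = card K" for K'
    using K(2)[of K'] K(1) that by (auto simp: Q'_def Q_def)
  define N where "N x = {u \<in> K. \<not> E x u}" for x
  have small': "False" if "T \<subseteq> S" "card T \<le> 5" "\<And>R. \<not> splits E T R" for T
    using small that by blast
  have nonempty: "N x \<noteq> {}" if "x \<in> S" "x \<notin> K" for x
  proof
    assume "N x = {}"
    then have "mono_set E True (insert x K)"
      using Kred sym that KS unfolding mono_set_def N_def by blast
    then show False using Kmax[of "insert x K"] that KS Kfin by simp
  qed
  \<comment> \<open>Nested blue neighbourhoods in \<open>K\<close> are the case where the degree-sum
    choice of \<open>K\<close> enters; incomparable ones give a red 4-cycle directly, at the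
    end.\<close>
  have no_edge: False if xy: "x \<in> S" "y \<in> S" "x \<notin> K" "y \<notin> K" "x \<noteq> y" "E x y" "N x \<subseteq> N y" for x y
  proof -
    have yx: "E y x" using xy sym by blast
    obtain u where u: "u \<in> N x" using nonempty xy by blast
    have uK: "u \<in> K" "u \<in> S" "\<not> E x u" "\<not> E y u" "u \<noteq> x" "u \<noteq> y"
      using u xy KS by (auto simp: N_def)
    have Nx: "N x = {u}"
    proof (rule ccontr)
      assume "N x \<noteq> {u}"
      then obtain v where v: "v \<in> N x" "v \<noteq> u" using u by blast
      have vK: "v \<in> K" "v \<in> S" "\<not> E x v" "\<not> E y v" "v \<noteq> x" "v \<noteq> y"
        using v xy KS by (auto simp: N_def)
      have "E u v" using Kred uK vK v by (auto simp: mono_set_def)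
      then show False
        by (intro small'[of "{x, y, u, v}"] not_splits_two_edges)
           (use xy uK vK v in \<open>auto simp: card_insert_if\<close>)
    qed
    have xK: "E x w" "E w x" if "w \<in> K" "w \<noteq> u" for w
      using Nx that xy sym KS unfolding N_def by blast+
    \<comment> \<open>If \<open>x\<close> and \<open>y\<close> both miss only \<open>u\<close>,
      replacing \<open>u\<close> by the two of them gives a larger red clique.\<close>
    have "N y \<noteq> {u}"
    proof
      assume Ny: "N y = {u}"
      have yK: "E y w" "E w y" if "w \<in> K" "w \<noteq> u" for w
        using Ny that xy sym KS unfolding N_def by blast+
      have "mono_set E True (insert x (insert y (K - {u})))"
        using Kred xK yK xy(6) yx unfolding mono_set_def by (auto split: if_splits)
      moreover have "card (insert x (insert y (K - {u}))) = Suc (card K)"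
        using xy Kfin uK by (simp add: card_Suc_Diff1 del: card_Diff_singleton card_Diff_insert)
      ultimately show False using Kmax[of "insert x (insert y (K - {u}))"] xy KS by auto
    qed
    then obtain v where v: "v \<in> N y" "v \<noteq> u" using u xy by blast
    then have vK: "v \<in> K" "v \<in> S" "\<not> E y v" "v \<noteq> x" "v \<noteq> y" "E x v" "E v x"
      using xy KS xK by (auto simp: N_def)
    have uv: "E u v" "E v u" using Kred uK vK v by (auto simp: mono_set_def)
    \<comment> \<open>Exchanging \<open>u\<close> for \<open>x\<close> gives another maximum red
      clique, so the choice by degree sum yields \<open>d x \<le> d u\<close>.\<close>
    have "mono_set E True (insert x (K - {u}))"
      using Kred xK unfolding mono_set_def by blast
    moreover have "card (insert x (K - {u})) = card K"
      using xy Kfin uK by (simp add: card_Suc_Diff1 del: card_Diff_singleton card_Diff_insert)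
    ultimately have "sum d (insert x (K - {u})) \<le> sum d K" using xy KS by (intro Kdeg) auto
    moreover have "sum d (insert x (K - {u})) = d x + sum d (K - {u})" using xy Kfin by simp
    moreover have "sum d K = d u + sum d (K - {u})" using Kfin uK by (simp add: sum.remove)
    ultimately have "d x \<le> d u" by simp
    \<comment> \<open>As \<open>y\<close> is a red neighbour of \<open>x\<close> but not of
      \<open>u\<close>, the inequality \<open>d x \<le> d u\<close> forces \<open>u\<close> to have
      a red neighbour \<open>z\<close> that \<open>x\<close> lacks.\<close>
    moreover have "y \<in> {w \<in> S. w \<noteq> x \<and> E x w}" "y \<notin> {w \<in> S. w \<noteq> u \<and> E u w}"
      using xy uK sym by auto
    ultimately have "\<not> {w \<in> S. w \<noteq> u \<and> E u w} \<subseteq> {w \<in> S. w \<noteq> x \<and> E x w}"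
      using psubset_card_mono[of "{w \<in> S. w \<noteq> x \<and> E x w}" "{w \<in> S. w \<noteq> u \<and> E u w}"] fin
      unfolding d_def by auto
    then obtain z where z: "z \<in> S" "z \<noteq> u" "E u z" "z = x \<or> \<not> E x z" by blast
    have zx: "z \<noteq> x" using z uK xy sym by blast
    have zy: "z \<noteq> y" using z uK xy sym by blast
    have zK: "z \<notin> K" using z zx xK by blast
    have zu: "E z u" using z sym uK by blast
    have zv: "z \<noteq> v" using zK vK by blast
    have "E y z"
    proof (rule ccontr)
      assume "\<not> E y z"
      then show False
        by (intro small'[of "{x, y, u, z}"] not_splits_two_edges)
           (use xy uK z zx zy in \<open>auto simp: card_insert_if\<close>)
    qed
    show False
    \<comment> \<open>If \<open>z\<close> and \<open>v\<close> are joined in red, then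
      \<open>x\<close>, \<open>y\<close>, \<open>z\<close>, \<open>v\<close> is a red 4-cycle;
      otherwise \<open>y\<close>, \<open>x\<close>, \<open>v\<close>, \<open>u\<close>,
      \<open>z\<close> is a red 5-cycle. The remaining pairs are blue in both cases.\<close>
    proof (cases "E z v")
      case True
      then show False
        using \<open>E y z\<close> xy vK z zx zy zv
        by (intro small'[of "{x, y, z, v}"] not_splits_4_cycle) (auto simp: card_insert_if)
    next
      case False
      have "\<not> E v y" "\<not> E u x" "\<not> E z x" "\<not> E v z" "\<not> E u y"
        using sym False vK uK z zx zy zv xy by blast+
      then show False
        using \<open>E y z\<close> xy vK z zx zy zv uv zu uK v(2) sym[of y z]
        by (intro small'[of "{y, x, v, u, z}"] not_splits_5_cycle)
           (use yx in \<open>auto simp: card_insert_if\<close>)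
    qed
  qed
  have "splits E S K"
    unfolding splits_def
  proof (intro ballI impI conjI)
    fix x y assume xy: "x \<in> S" "y \<in> S" "x \<noteq> y" "x \<notin> K \<and> y \<notin> K"
    show "\<not> E x y"
    proof
      assume e: "E x y"
      then have e': "E y x" using sym xy by blast
      have "\<not> N x \<subseteq> N y" "\<not> N y \<subseteq> N x" using no_edge[of x y] no_edge[of y x] xy e e' by blast+
      \<comment> \<open>One witness for each failed inclusion gives the red 4-cycle
        \<open>x\<close>, \<open>v\<close>, \<open>u\<close>, \<open>y\<close> with blue
        diagonals.\<close>
      then obtain u v where "u \<in> N x" "u \<notin> N y" "v \<in> N y" "v \<notin> N x" by blast
      then have uv: "u \<in> K" "v \<in> K" "\<not> E x u" "E y u" "\<not> E y v" "E x v" "u \<noteq> v" by (auto simp: N_def)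
      then have "u \<noteq> y" "v \<noteq> y" "u \<in> S" "v \<in> S" using xy KS by auto
      then have "E v u" "E u y" "\<not> E x u" "\<not> E v y"
        using Kred uv xy sym[of u y] sym[of v y] by (auto simp: mono_set_def)
      then show False
        by (intro small'[of "{x, v, u, y}"] not_splits_4_cycle)
           (use uv xy e e' KS in \<open>auto simp: card_insert_if\<close>)
    qed
  qed (use Kred in \<open>auto simp: mono_set_def\<close>)
  then show ?thesis by blast
qed

section \<open>Averaging and pigeonhole on finite sets\<close>

text \<open>Elements of \<open>A\<close> below the threshold contribute at most half of the assumed
  total; the other half comes from elements contributing at most \<open>card B\<close> each.\<close>

lemma card_mult_average:
  fixes c :: real
  assumes "finite A" "finite B" "B \<noteq> {}"
    and "c * card A * card B \<le> (\<Sum>a\<in>A. real (card {b\<in>B. P a b}))"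
  shows "c / 2 * card A \<le> card {a\<in>A. c / 2 * card B \<le> card {b\<in>B. P a b}}"
proof (cases "c < 0")
  case True
  then have "c / 2 * card A \<le> 0" by (simp add: mult_nonpos_nonneg)
  then show ?thesis by linarith
next
  case False
  define G where "G = {a\<in>A. c / 2 * card B \<le> card {b\<in>B. P a b}}"
  have "(\<Sum>a\<in>A. real (card {b\<in>B. P a b})) \<le> (\<Sum>a\<in>A. of_bool (a \<in> G) * real (card B) + c / 2 * card B)"
  proof (rule sum_mono)
    fix a assume "a \<in> A"
    have "card {b\<in>B. P a b} \<le> card B" using assms by (intro card_mono) auto
    moreover have "0 \<le> c / 2 * real (card B)" using False by simp
    ultimately show "real (card {b\<in>B. P a b}) \<le> of_bool (a \<in> G) * real (card B) + c / 2 * card B"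
      using \<open>a \<in> A\<close> by (cases "a \<in> G") (auto simp: G_def)
  qed
  also have "\<dots> = card G * real (card B) + c / 2 * card A * card B"
    using assms(1) by (simp add: sum.distrib flip: sum_distrib_right)
      (simp add: of_bool_def sum.If_cases G_def Int_def)
  finally have "c / 2 * card A * card B \<le> card G * real (card B)" using assms(4) by (simp add: field_simps)
  moreover have "real (card B) > 0" using assms by (simp add: card_gt_0_iff)
  ultimately show ?thesis unfolding G_def[symmetric] by simp
qed

lemma large_fibre:
  fixes c :: real
  assumes "finite A" "finite B" "\<And>a. a \<in> A \<Longrightarrow> f a \<in> B" "B \<noteq> {}"
  shows "\<exists>b\<in>B. card A / card B \<le> card {a\<in>A. f a = b}"
proof (rule ccontr)
  assume "\<not> ?thesis"
  then have *: "real (card {a\<in>A. f a = b}) < card A / card B" if "b \<in> B" for b using that by force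
  have "real (card A) = (\<Sum>b\<in>B. real (card {a\<in>A. f a = b}))"
    using sum.group[of A B f "\<lambda>_. 1::real"] assms by (simp add: image_subset_iff)
  also have "\<dots> < (\<Sum>b\<in>B. card A / card B)" using * assms by (intro sum_strict_mono) auto
  also have "\<dots> = card A" using assms by simp
  finally show False by simp
qed

section \<open>Blow-ups of colour patterns\<close>

text \<open>Only the entries of \<open>\<chi>\<close> at \<open>i < j\<close> are consulted,
  membership meaning red. Removing the last vertex of a tuple thus leaves the same
  \<open>\<chi>\<close> valid, which lets the induction on \<open>r\<close> keep it fixed.\<close>

definition pattern_tuples :: "('a \<Rightarrow> 'a \<Rightarrow> bool) \<Rightarrow> 'a set \<Rightarrow> nat \<Rightarrow> (nat \<times> nat) set \<Rightarrow> 'a list set" where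
  "pattern_tuples E V r \<chi> = {xs. length xs = r \<and> set xs \<subseteq> V \<and>
     (\<forall>i j. i < j \<longrightarrow> j < r \<longrightarrow> xs ! i \<noteq> xs ! j \<and> E (xs ! i) (xs ! j) = ((i, j) \<in> \<chi>))}"

text \<open>The \<open>i\<close>-th part of the blow-up is \<open>{w l ! i | l \<in> L}\<close>. Indexing all parts by \<open>L\<close> keeps track of
  \<open>card L\<close> disjoint transversals \<open>w l\<close>, which the induction on the number of parts requires to lie
  in the given family.\<close>
definition mono_blowup ::
    "('a \<Rightarrow> 'a \<Rightarrow> bool) \<Rightarrow> nat \<Rightarrow> (nat \<times> nat) set \<Rightarrow> nat set \<Rightarrow> (nat \<Rightarrow> 'a list) \<Rightarrow> bool" where
  "mono_blowup E r \<chi> L w \<longleftrightarrow>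
     (\<forall>i<r. inj_on (\<lambda>l. w l ! i) L \<and> (\<exists>c. mono_set E c ((\<lambda>l. w l ! i) ` L))) \<and>
     (\<forall>i j. i < j \<longrightarrow> j < r \<longrightarrow> (\<forall>l\<in>L. \<forall>l'\<in>L.
        w l ! i \<noteq> w l' ! j \<and> E (w l ! i) (w l' ! j) = ((i, j) \<in> \<chi>)))"

text \<open>Blow up the tuples of length \<open>r\<close> having many extensions first. Since \<open>L\<close> has only \<open>2 ^ card L\<close>
  subsets, many vertices extend the same subset \<open>L'\<close> of its transversals, and Ramsey's theorem
  finds the last part among them.\<close>
lemma mono_blowup_exists:
  fixes V :: "'a set" and c :: real
  assumes fin: "finite V" and sym: "\<And>u v. u \<in> V \<Longrightarrow> v \<in> V \<Longrightarrow> u \<noteq> v \<Longrightarrow> E u v = E v u"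
  shows "\<lbrakk>0 < c; M \<subseteq> pattern_tuples E V r \<chi>; c * card V ^ r \<le> card M; 0 < m;
     8 ^ m \<le> c / 2 ^ Suc r * card V\<rbrakk> \<Longrightarrow>
     \<exists>L w. finite L \<and> w ` L \<subseteq> M \<and> mono_blowup E r \<chi> L w \<and>
       (c / 2 ^ Suc r) ^ r * m \<le> card L \<and> card L \<le> m"
proof (induction r arbitrary: c M)
  case 0
  have "M \<noteq> {}" using 0 by auto
  then have "[] \<in> M" using 0(2) by (auto simp: pattern_tuples_def)
  \<comment> \<open>With no parts to build, any \<open>m\<close> indices will do, all carrying the
    empty tuple.\<close>
  then show ?case
    by (intro exI[of _ "{..<m}"] exI[of _ "\<lambda>_. []"]) (auto simp: mono_blowup_def)
next
  case (Suc r)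
  define n where "n = card V"
  have "(0::real) < 8 ^ m" by simp
  then have "0 < c / 2 ^ Suc (Suc r) * n" using Suc.prems(5) unfolding n_def by linarith
  then have n: "n > 0" by (cases "n = 0") auto
  then have V: "V \<noteq> {}" using fin by (auto simp: n_def)
  define D where "D = {xs. set xs \<subseteq> V \<and> length xs = r}"
  have D: "finite D" "card D = n ^ r"
    using fin finite_lists_length_eq card_lists_length_eq by (auto simp: D_def n_def)
  define M' where "M' = {xs\<in>D. c / 2 * n \<le> card {v\<in>V. xs @ [v] \<in> M}}"
  have "bij_betw (\<lambda>(xs, v). xs @ [v]) (SIGMA xs:D. {v\<in>V. xs @ [v] \<in> M}) M"
  proof (rule bij_betwI[where g = "\<lambda>ys. (butlast ys, last ys)"])
    show "(\<lambda>ys. (butlast ys, last ys)) \<in> M \<rightarrow> (SIGMA xs:D. {v\<in>V. xs @ [v] \<in> M})"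
    proof
      fix ys assume ys: "ys \<in> M"
      then have *: "length ys = Suc r" "set ys \<subseteq> V" "ys \<noteq> []"
        using Suc.prems(2) by (auto simp: pattern_tuples_def)
      then have "last ys \<in> V" "set (butlast ys) \<subseteq> V"
        using last_in_set in_set_butlastD by (metis subsetD, metis subsetD subsetI)
      then show "(butlast ys, last ys) \<in> (SIGMA xs:D. {v\<in>V. xs @ [v] \<in> M})" using ys * by (auto simp: D_def)
    qed
    show "(case (butlast y, last y) of (xs, v) \<Rightarrow> xs @ [v]) = y" if "y \<in> M" for y
    proof -
      have "y \<noteq> []" using that Suc.prems(2) by (auto simp: pattern_tuples_def)
      then show ?thesis by simp
    qed
  qed auto
  then have "card M = (\<Sum>xs\<in>D. card {v\<in>V. xs @ [v] \<in> M})"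
    using D(1) fin by (simp add: bij_betw_same_card[symmetric])
  then have "c * card D * card V \<le> (\<Sum>xs\<in>D. real (card {v\<in>V. xs @ [v] \<in> M}))"
    using Suc.prems(3) D(2) by (simp add: n_def mult.commute mult.left_commute flip: of_nat_sum)
  from card_mult_average[OF D(1) fin V this]
  have cardM': "c / 2 * n ^ r \<le> card M'" by (simp add: M'_def D(2) n_def)
  have M': "M' \<subseteq> pattern_tuples E V r \<chi>"
  proof
    fix xs assume xs: "xs \<in> M'"
    have "0 < c / 2 * n" using Suc.prems(1) n by simp
    then have "card {v\<in>V. xs @ [v] \<in> M} \<noteq> 0" using xs unfolding M'_def by force
    then have "{v\<in>V. xs @ [v] \<in> M} \<noteq> {}" by force
    then obtain v where "xs @ [v] \<in> M" by blast
    then have "xs @ [v] \<in> pattern_tuples E V (Suc r) \<chi>" using Suc.prems(2) by blast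
    then have *: "length xs = r" "set xs \<subseteq> V"
      "\<And>i j. i < j \<Longrightarrow> j < Suc r \<Longrightarrow> (xs @ [v]) ! i \<noteq> (xs @ [v]) ! j \<and> E ((xs @ [v]) ! i) ((xs @ [v]) ! j) = ((i, j) \<in> \<chi>)"
      by (auto simp: pattern_tuples_def)
    have "xs ! i \<noteq> xs ! j \<and> E (xs ! i) (xs ! j) = ((i, j) \<in> \<chi>)" if "i < j" "j < r" for i j
      using *(3)[of i j] that *(1) by (simp add: nth_append)
    then show "xs \<in> pattern_tuples E V r \<chi>" using * by (auto simp: pattern_tuples_def)
  qed
  \<comment> \<open>Halving \<open>c\<close> while \<open>r\<close> drops by one leaves
    \<open>c / 2 ^ Suc r\<close> unchanged, so the size condition on \<open>8 ^ m\<close> passes to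
    the induction hypothesis as it stands.\<close>
  obtain L w where L: "finite L" "w ` L \<subseteq> M'" "mono_blowup E r \<chi> L w"
    "(c / 2 / 2 ^ Suc r) ^ r * m \<le> card L" "card L \<le> m"
    using Suc.IH[of "c / 2" M'] Suc.prems M' cardM' by (auto simp: n_def)
  have "0 < (c / 2 / 2 ^ Suc r) ^ r * m" using Suc.prems by simp
  then have "L \<noteq> {}" using L(4) by force
  \<comment> \<open>Double counting the admissible pairs of \<open>l\<close> and \<open>v\<close>
    shows that \<open>N v\<close> has at least \<open>c / 2 * card L\<close> elements on average, so
    the vertices collected in \<open>X\<close> below make up at least a share \<open>c / 4\<close>
    of \<open>V\<close>.\<close>
  define N where "N v = {l\<in>L. w l @ [v] \<in> M}" for v
  have "c / 2 * card V * card L = (\<Sum>l\<in>L. c / 2 * n)" by (simp add: n_def)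
  also have "\<dots> \<le> (\<Sum>l\<in>L. real (card {v\<in>V. w l @ [v] \<in> M}))"
    using L(2) by (intro sum_mono) (auto simp: M'_def)
  also have "\<dots> = (\<Sum>v\<in>V. real (card (N v)))"
    using sum_multicount_gen[of L V "\<lambda>l v. w l @ [v] \<in> M" "\<lambda>v. card (N v)"] L(1) fin
    by (auto simp: N_def simp flip: of_nat_sum)
  finally have avg: "c / 2 * card V * card L \<le> (\<Sum>v\<in>V. real (card {l\<in>L. w l @ [v] \<in> M}))" by (simp add: N_def)
  define X where "X = {v\<in>V. c / 4 * card L \<le> card (N v)}"
  have X: "c / 4 * n \<le> card X"
    using card_mult_average[OF fin L(1) \<open>L \<noteq> {}\<close> avg] by (simp add: X_def N_def n_def)
  have finX: "finite X" using fin by (simp add: X_def)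
  obtain L' where L': "L' \<subseteq> L" "card X / card (Pow L) \<le> card {v\<in>X. N v = L'}"
    using large_fibre[of X "Pow L" N] finX L(1) by (auto simp: N_def)
  define Y where "Y = {v\<in>X. N v = L'}"
  have finL': "finite L'" using L' L finite_subset by blast
  \<comment> \<open>Of the factor \<open>8 ^ m\<close>, the pigeonhole over subsets of
    \<open>L\<close> costs \<open>2 ^ m\<close>; the remaining \<open>4 ^ m\<close> suffices for
    Ramsey with both clique sizes equal to \<open>card L'\<close>.\<close>
  have "real (4 ^ card L') \<le> 4 ^ m"
    using card_mono[OF L(1) L'(1)] L(5) by (auto intro: power_increasing)
  also have "\<dots> = 8 ^ m / 2 ^ m" by (simp add: power_divide[symmetric])
  also have "\<dots> \<le> (c / 4 * n) / 2 ^ m"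
  proof (rule divide_right_mono)
    have "c / 2 ^ Suc (Suc r) \<le> c / 4" using Suc.prems(1) by (intro divide_left_mono) auto
    then have "c / 2 ^ Suc (Suc r) * n \<le> c / 4 * n" by (intro mult_right_mono) auto
    then show "8 ^ m \<le> c / 4 * n" using Suc.prems(5)[folded n_def] by linarith
  qed simp
  also have "\<dots> \<le> card X / 2 ^ m" using X by (intro divide_right_mono) auto
  also have "\<dots> \<le> card X / 2 ^ card L" using L(5) by (intro divide_left_mono power_increasing) auto
  also have "\<dots> \<le> card Y" using L'(2) L(1) by (simp add: Y_def card_Pow)
  finally have "4 ^ card L' \<le> card Y" by linarith
  then have "2 ^ (card L' + card L') \<le> card Y" by (simp add: power_add flip: power_mult_distrib)
  have finY: "finite Y" using finX by (simp add: Y_def)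
  have "(\<exists>K\<subseteq>Y. card K = card L' \<and> mono_set E True K) \<or> (\<exists>K\<subseteq>Y. card K = card L' \<and> mono_set E False K)"
    by (rule ramsey_power2[OF finY \<open>2 ^ (card L' + card L') \<le> card Y\<close>]) (simp add: sym Y_def X_def)
  then obtain K b where K: "K \<subseteq> Y" "card K = card L'" "mono_set E b K" by blast
  have "finite K" using K(1) finY finite_subset by blast
  \<comment> \<open>Every vertex of \<open>K\<close> extends every transversal indexed by
    \<open>L'\<close>, so any bijection may distribute the new entries. Asking Ramsey for exactly
    \<open>card L'\<close> vertices keeps all parts indexed by the same set.\<close>
  then obtain g where g: "bij_betw g L' K" using finite_same_card_bij[OF finL'] K(2) by metis
  define w' where "w' l = w l @ [g l]" for l
  \<comment> \<open>The second fact mixes indices: it determines the colours between an old part and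
    the whole new part, not only inside one transversal.\<close>
  have w'M: "w' l \<in> M" "w l @ [g l'] \<in> M" if "l \<in> L'" "l' \<in> L'" for l l'
  proof -
    have "g l \<in> Y" "g l' \<in> Y" using that g K(1) by (auto simp: bij_betw_def)
    then show "w' l \<in> M" "w l @ [g l'] \<in> M" using that by (auto simp: Y_def N_def w'_def)
  qed
  have len: "length (w l) = r" if "l \<in> L'" for l
    using that L' L(2) M' by (auto simp: pattern_tuples_def)
  have "mono_blowup E (Suc r) \<chi> L' w'"
    unfolding mono_blowup_def
  proof (intro conjI allI impI ballI)
    fix i assume i: "i < Suc r"
    have "inj_on (\<lambda>l. w' l ! i) L' \<and> (\<exists>c. mono_set E c ((\<lambda>l. w' l ! i) ` L'))"
    proof (cases "i < r")
      case True
      then have *: "w' l ! i = w l ! i" if "l \<in> L'" for l using len that by (simp add: w'_def nth_append)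
      obtain a where "inj_on (\<lambda>l. w l ! i) L" "mono_set E a ((\<lambda>l. w l ! i) ` L)"
        using L(3) True unfolding mono_blowup_def by blast
      then have "inj_on (\<lambda>l. w l ! i) L'" "mono_set E a ((\<lambda>l. w l ! i) ` L')"
        using L'(1) inj_on_subset unfolding mono_set_def by blast+
      moreover have "inj_on (\<lambda>l. w' l ! i) L' = inj_on (\<lambda>l. w l ! i) L'" by (rule inj_on_cong) (rule *)
      moreover have "(\<lambda>l. w' l ! i) ` L' = (\<lambda>l. w l ! i) ` L'" by (rule image_cong[OF refl]) (rule *)
      ultimately show ?thesis by auto
    next
      case False
      then have *: "w' l ! i = g l" if "l \<in> L'" for l using i len that by (simp add: w'_def nth_append)
      have "inj_on (\<lambda>l. w' l ! i) L' = inj_on g L'" by (rule inj_on_cong) (rule *)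
      moreover have "(\<lambda>l. w' l ! i) ` L' = g ` L'" by (rule image_cong[OF refl]) (rule *)
      ultimately show ?thesis using K(3) g by (auto simp: bij_betw_def)
    qed
    then show "inj_on (\<lambda>l. w' l ! i) L'" and "\<exists>c. mono_set E c ((\<lambda>l. w' l ! i) ` L')" by auto
  next
    fix i j l l' assume ij: "i < j" "j < Suc r" and l: "l \<in> L'" "l' \<in> L'"
    show "w' l ! i \<noteq> w' l' ! j" and "E (w' l ! i) (w' l' ! j) = ((i, j) \<in> \<chi>)"
    proof (atomize(full), cases "j < r")
      case True
      then show "w' l ! i \<noteq> w' l' ! j \<and> E (w' l ! i) (w' l' ! j) = ((i, j) \<in> \<chi>)"
        using L(3) L'(1) ij(1) l len unfolding mono_blowup_def by (simp add: w'_def nth_append subset_iff)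
    next
      case False
      then have j: "j = r" using ij by simp
      have "w l @ [g l'] \<in> pattern_tuples E V (Suc r) \<chi>" using w'M(2)[OF l] Suc.prems(2) by blast
      then have "(w l @ [g l']) ! i \<noteq> (w l @ [g l']) ! r \<and>
          E ((w l @ [g l']) ! i) ((w l @ [g l']) ! r) = ((i, r) \<in> \<chi>)"
        using ij j unfolding pattern_tuples_def by blast
      then show "w' l ! i \<noteq> w' l' ! j \<and> E (w' l ! i) (w' l' ! j) = ((i, j) \<in> \<chi>)"
        using ij j l len by (auto simp: w'_def nth_append)
    qed
  qed
  moreover have "(c / 2 ^ Suc (Suc r)) ^ Suc r * m \<le> card L'"
  proof -
    \<comment> \<open>Any \<open>v\<close> in \<open>Y\<close> has \<open>N v = L'\<close>, and
      membership in \<open>X\<close> bounds this set from below. One induction step therefore keeps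
      at least a share \<open>c / 4\<close> of the indices.\<close>
    obtain v where v: "v \<in> X" "N v = L'"
    proof -
      have "(1::nat) \<le> 4 ^ card L'" by simp
      then have "Y \<noteq> {}" using \<open>4 ^ card L' \<le> card Y\<close> by (metis card.empty not_one_le_zero order.trans)
      then show ?thesis using that by (auto simp: Y_def)
    qed
    have "c / 2 ^ Suc (Suc r) \<le> c / 4" using Suc.prems(1) by (intro divide_left_mono) auto
    then have "(c / 2 ^ Suc (Suc r)) * ((c / 2 ^ Suc (Suc r)) ^ r * m) \<le> c / 4 * ((c / 2 ^ Suc (Suc r)) ^ r * m)"
      using Suc.prems(1) by (intro mult_right_mono) auto
    also have "\<dots> \<le> c / 4 * card L" using L(4) Suc.prems(1) by (intro mult_left_mono) auto
    also have "\<dots> \<le> card L'" using v by (auto simp: X_def)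
    finally show ?thesis by (simp add: mult.assoc)
  qed
  moreover have "card L' \<le> m" using card_mono[OF L(1) L'(1)] L(5) by linarith
  moreover have "w' ` L' \<subseteq> M" using w'M(1) by auto
  ultimately show ?case using finL' by blast
qed

text \<open>If any two parts of the same colour were also joined in that colour, each transversal
  would be split, with \<open>R\<close> its vertices in red parts. A non-split transversal thus
  exposes two like-coloured parts joined in the other colour.\<close>

lemma alternating_pair_from_blowup:
  assumes sym: "\<And>u v. u \<in> V \<Longrightarrow> v \<in> V \<Longrightarrow> u \<noteq> v \<Longrightarrow> E u v = E v u"
    and M: "M \<subseteq> pattern_tuples E V r \<chi>" "\<And>xs R. xs \<in> M \<Longrightarrow> \<not> splits E (set xs) R"
    and L: "w ` L \<subseteq> M" "mono_blowup E r \<chi> L w" "L \<noteq> {}"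
  shows "\<exists>A B c. A \<subseteq> V \<and> B \<subseteq> V \<and> A \<inter> B = {} \<and> card A = card L \<and> card B = card L \<and>
     mono_set E c A \<and> mono_set E c B \<and> (\<forall>u\<in>A. \<forall>v\<in>B. E u v = (\<not> c))"
proof -
  define part where "part i = (\<lambda>l. w l ! i) ` L" for i
  obtain l where l: "l \<in> L" using L by blast
  have wP: "w l \<in> pattern_tuples E V r \<chi>" if "l \<in> L" for l using that L M by blast
  then have len: "length (w l) = r" if "l \<in> L" for l using that by (auto simp: pattern_tuples_def)
  have partV: "part i \<subseteq> V" if "i < r" for i
    using wP len that unfolding part_def pattern_tuples_def by (force dest: nth_mem)
  have card_part: "card (part i) = card L" if "i < r" for i
    using L(2) that by (auto simp: mono_blowup_def part_def card_image)
  \<comment> \<open>A part with one vertex is monochromatic in both colours; \<open>col\<close>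
    fixes one of them, and the argument works for either choice.\<close>
  have "\<forall>i. \<exists>c. i < r \<longrightarrow> mono_set E c (part i)" using L(2) by (auto simp: mono_blowup_def part_def)
  then obtain col where col: "\<And>i. i < r \<Longrightarrow> mono_set E (col i) (part i)" by metis
  define R where "R = {w l ! i |i. i < r \<and> col i}"
  have "\<not> splits E (set (w l)) R" using M l L by blast
  then obtain u v where uv: "u \<in> set (w l)" "v \<in> set (w l)" "u \<noteq> v"
      "(u \<in> R) = (v \<in> R)" "E u v \<noteq> (u \<in> R)"
    unfolding splits_def by blast
  then obtain i j where ij: "i < r" "j < r" "u = w l ! i" "v = w l ! j"
    using len[OF l] by (auto simp: in_set_conv_nth)
  have dist: "distinct (w l)"
    using wP[OF l] len[OF l] unfolding distinct_conv_nth pattern_tuples_def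
    by (smt (verit, ccfv_SIG) mem_Collect_eq nat_neq_iff)
  have R: "w l ! a \<in> R \<longleftrightarrow> col a" if "a < r" for a
    using that dist len[OF l] by (auto simp: R_def nth_eq_iff_index_eq)
  \<comment> \<open>The blow-up records colours for increasing indices only; symmetry of
    \<open>E\<close> brings the pair found above into this order.\<close>
  have main: ?thesis if "i < j" "j < r" "col i = col j" "E (w l ! i) (w l ! j) \<noteq> col i" for i j
  proof (intro exI conjI)
    have ij: "w a ! i \<noteq> w b ! j" "E (w a ! i) (w b ! j) = ((i, j) \<in> \<chi>)" if "a \<in> L" "b \<in> L" for a b
      using L(2) that \<open>i < j\<close> \<open>j < r\<close> unfolding mono_blowup_def by blast+
    show "part i \<inter> part j = {}" using ij by (auto simp: part_def)
    show "\<forall>u\<in>part i. \<forall>v\<in>part j. E u v = (\<not> col i)"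
      using ij that(4) l by (auto simp: part_def)
    show "part i \<subseteq> V" "part j \<subseteq> V" "card (part i) = card L" "card (part j) = card L"
      using partV card_part that by auto
    show "mono_set E (col i) (part i)" using col that(1,2) by simp
    show "mono_set E (col i) (part j)" unfolding that(3) using col that(2) by simp
  qed
  have "E v u = E u v" using sym uv partV ij l by (auto simp: part_def image_subset_iff)
  moreover have "i \<noteq> j" using ij uv by auto
  ultimately show ?thesis
    using main[of i j] main[of j i] ij uv R by (metis nat_neq_iff)
qed

section \<open>Moments and collisions of random samples\<close>

text \<open>Fubini for a single coordinate: one independent sample point is summed out while the
  others stay fixed.\<close>

lemma sum_PiE_coord:
  fixes h :: "('i \<Rightarrow> 'a) \<Rightarrow> 'b::comm_monoid_add"
  assumes "i \<in> I"
  shows "(\<Sum>f\<in>I \<rightarrow>\<^sub>E V. h f) = (\<Sum>f\<in>(I - {i}) \<rightarrow>\<^sub>E V. \<Sum>v\<in>V. h (f(i := v)))"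
proof -
  have "I \<rightarrow>\<^sub>E V = insert i (I - {i}) \<rightarrow>\<^sub>E V" using assms by (simp add: insert_absorb)
  also have "\<dots> = (\<lambda>(y, g). g(i := y)) ` (V \<times> ((I - {i}) \<rightarrow>\<^sub>E V))" by (rule PiE_insert_eq)
  finally have "(\<Sum>f\<in>I \<rightarrow>\<^sub>E V. h f) = (\<Sum>(y, g)\<in>V \<times> ((I - {i}) \<rightarrow>\<^sub>E V). h (g(i := y)))"
    using inj_combinator[of i "I - {i}" "\<lambda>_. V"] by (simp add: sum.reindex case_prod_unfold)
  also have "\<dots> = (\<Sum>y\<in>V. \<Sum>g\<in>(I - {i}) \<rightarrow>\<^sub>E V. h (g(i := y)))"
    by (simp add: sum.cartesian_product)
  finally show ?thesis by (subst (asm) sum.swap)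
qed

lemma card_PiE_const: "finite I \<Longrightarrow> card (I \<rightarrow>\<^sub>E V) = card V ^ card I"
  by (simp add: card_PiE)

text \<open>For a random \<open>f\<close> and fixed \<open>f i\<close> the summands are independent with mean zero.\<close>
lemma sum_sampled_squares_le:
  fixes \<phi> :: "'a \<Rightarrow> 'a \<Rightarrow> real"
  assumes "finite I" "i \<in> I" "finite V"
    and mean: "\<And>v. v \<in> V \<Longrightarrow> (\<Sum>u\<in>V. \<phi> v u) = 0"
    and bound: "\<And>u v. u \<in> V \<Longrightarrow> v \<in> V \<Longrightarrow> \<bar>\<phi> v u\<bar> \<le> 1"
  shows "(\<Sum>f\<in>I \<rightarrow>\<^sub>E V. (\<Sum>j\<in>I - {i}. \<phi> (f i) (f j))\<^sup>2) \<le> card I * card V ^ card I"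
proof -
  have "(\<Sum>f\<in>I \<rightarrow>\<^sub>E V. \<phi> (f i) (f j) * \<phi> (f i) (f l)) \<le> of_bool (j = l) * real (card V ^ card I)"
    if jl: "j \<in> I - {i}" "l \<in> I - {i}" for j l
  proof (cases "j = l")
    case True
    have "(\<Sum>f\<in>I \<rightarrow>\<^sub>E V. \<phi> (f i) (f j) * \<phi> (f i) (f l)) \<le> (\<Sum>f\<in>I \<rightarrow>\<^sub>E V. 1)"
    proof (rule sum_mono)
      fix f assume "f \<in> I \<rightarrow>\<^sub>E V"
      then have "\<bar>\<phi> (f i) (f j)\<bar> \<le> 1" using bound assms(2) jl by (auto simp: PiE_mem)
      then show "\<phi> (f i) (f j) * \<phi> (f i) (f l) \<le> 1"
        using True abs_square_le_1 by (auto simp: power2_eq_square)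
    qed
    then show ?thesis using True assms(1) by (simp add: card_PiE_const)
  next
    case False
    \<comment> \<open>For \<open>j \<noteq> l\<close> only one factor depends on \<open>f j\<close>,
      and its sum over \<open>V\<close> is zero by \<open>mean\<close>.\<close>
    have "(\<Sum>f\<in>I \<rightarrow>\<^sub>E V. \<phi> (f i) (f j) * \<phi> (f i) (f l)) =
      (\<Sum>f\<in>(I - {j}) \<rightarrow>\<^sub>E V. \<phi> (f i) (f l) * (\<Sum>v\<in>V. \<phi> (f i) v))"
    proof (subst sum_PiE_coord[of j])
      show "(\<Sum>f\<in>(I - {j}) \<rightarrow>\<^sub>E V. \<Sum>v\<in>V. \<phi> ((f(j := v)) i) ((f(j := v)) j) * \<phi> ((f(j := v)) i) ((f(j := v)) l)) =
        (\<Sum>f\<in>(I - {j}) \<rightarrow>\<^sub>E V. \<phi> (f i) (f l) * (\<Sum>v\<in>V. \<phi> (f i) v))"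
        unfolding sum_distrib_left using jl False by (intro sum.cong refl) (auto simp: mult.commute)
    qed (use jl in simp)
    also have "\<dots> = 0"
      using mean assms(2) jl by (intro sum.neutral ballI) (auto simp: PiE_mem)
    finally show ?thesis using False by simp
  qed
  then have "(\<Sum>j\<in>I - {i}. \<Sum>l\<in>I - {i}. \<Sum>f\<in>I \<rightarrow>\<^sub>E V. \<phi> (f i) (f j) * \<phi> (f i) (f l))
    \<le> (\<Sum>j\<in>I - {i}. \<Sum>l\<in>I - {i}. of_bool (j = l) * real (card V ^ card I))"
    by (intro sum_mono)
  also have "\<dots> = (\<Sum>j\<in>I - {i}. real (card V ^ card I))"
    using assms(1) by (intro sum.cong) (auto simp: of_bool_def if_distrib[of "\<lambda>x. x * _"] cong: if_cong)
  also have "\<dots> \<le> card I * card V ^ card I"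
    using assms(1) by (auto intro!: mult_right_mono card_mono)
  finally have "(\<Sum>j\<in>I - {i}. \<Sum>l\<in>I - {i}. \<Sum>f\<in>I \<rightarrow>\<^sub>E V. \<phi> (f i) (f j) * \<phi> (f i) (f l)) \<le> card I * card V ^ card I" .
  moreover have "(\<Sum>f\<in>I \<rightarrow>\<^sub>E V. (\<Sum>j\<in>I - {i}. \<phi> (f i) (f j))\<^sup>2) =
    (\<Sum>j\<in>I - {i}. \<Sum>l\<in>I - {i}. \<Sum>f\<in>I \<rightarrow>\<^sub>E V. \<phi> (f i) (f j) * \<phi> (f i) (f l))"
    by (simp add: power2_eq_square sum_product)
      (subst sum.swap, rule sum.cong[OF refl], rule sum.swap)
  ultimately show ?thesis by simp
qed

text \<open>Union bound: each ordered pair of distinct positions collides in a share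
  \<open>1 / card V\<close> of all samples. Multiplying by \<open>card V\<close> keeps the statement
  in the natural numbers.\<close>

lemma card_noninjective_le:
  assumes "finite I" "finite V"
  shows "card V * card {f \<in> I \<rightarrow>\<^sub>E V. \<not> inj_on f I} \<le> (card I)\<^sup>2 * card V ^ card I"
proof -
  have pair: "card {f \<in> I \<rightarrow>\<^sub>E V. f i = f j} * card V \<le> card V ^ card I" if "i \<in> I" "j \<in> I" "i \<noteq> j" for i j
  proof -
    have "card {f \<in> I \<rightarrow>\<^sub>E V. f i = f j} = (\<Sum>f\<in>I \<rightarrow>\<^sub>E V. of_bool (f i = f j))"
      using assms by (simp add: finite_PiE Int_def)
    also have "\<dots> = (\<Sum>f\<in>(I - {i}) \<rightarrow>\<^sub>E V. \<Sum>v\<in>V. of_bool (v = f j))"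
      using that by (subst sum_PiE_coord[of i]) auto
    also have "\<dots> = (\<Sum>f\<in>(I - {i}) \<rightarrow>\<^sub>E V. 1)"
      using that assms by (intro sum.cong) (auto simp: of_bool_def PiE_mem)
    also have "\<dots> = card V ^ (card I - 1)" using assms that by (simp add: card_PiE_const)
    finally have "card {f \<in> I \<rightarrow>\<^sub>E V. f i = f j} * card V = card V ^ Suc (card I - 1)" by simp
    also have "Suc (card I - 1) = card I" using that assms card_gt_0_iff[of I] by auto
    finally show ?thesis by simp
  qed
  have "{f \<in> I \<rightarrow>\<^sub>E V. \<not> inj_on f I} \<subseteq>
    (\<Union>(i, j)\<in>{(i, j). i \<in> I \<and> j \<in> I \<and> i \<noteq> j}. {f \<in> I \<rightarrow>\<^sub>E V. f i = f j})"
    by (auto simp: inj_on_def)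
  moreover have finP: "finite {(i, j). i \<in> I \<and> j \<in> I \<and> i \<noteq> j}"
    by (rule finite_subset[of _ "I \<times> I"]) (use assms in auto)
  ultimately have "card {f \<in> I \<rightarrow>\<^sub>E V. \<not> inj_on f I} \<le>
    card (\<Union>(i, j)\<in>{(i, j). i \<in> I \<and> j \<in> I \<and> i \<noteq> j}. {f \<in> I \<rightarrow>\<^sub>E V. f i = f j})"
    using assms by (intro card_mono) (auto simp: finite_PiE)
  also have "\<dots> \<le> (\<Sum>(i, j)\<in>{(i, j). i \<in> I \<and> j \<in> I \<and> i \<noteq> j}. card {f \<in> I \<rightarrow>\<^sub>E V. f i = f j})"
    using card_UN_le[OF finP] by (simp add: case_prod_unfold)
  finally have "card V * card {f \<in> I \<rightarrow>\<^sub>E V. \<not> inj_on f I} \<le>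
    card V * (\<Sum>(i, j)\<in>{(i, j). i \<in> I \<and> j \<in> I \<and> i \<noteq> j}. card {f \<in> I \<rightarrow>\<^sub>E V. f i = f j})"
    by (rule mult_left_mono) simp
  also have "\<dots> = (\<Sum>(i, j)\<in>{(i, j). i \<in> I \<and> j \<in> I \<and> i \<noteq> j}. card {f \<in> I \<rightarrow>\<^sub>E V. f i = f j} * card V)"
    by (simp add: sum_distrib_left case_prod_unfold mult.commute)
  also have "\<dots> \<le> (\<Sum>(i, j)\<in>{(i, j). i \<in> I \<and> j \<in> I \<and> i \<noteq> j}. card V ^ card I)"
    using pair by (intro sum_mono) auto
  also have "\<dots> = card {(i, j). i \<in> I \<and> j \<in> I \<and> i \<noteq> j} * card V ^ card I" by (simp add: case_prod_unfold)
  also have "\<dots> \<le> (card I)\<^sup>2 * card V ^ card I"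
  proof (rule mult_right_mono)
    have "card {(i, j). i \<in> I \<and> j \<in> I \<and> i \<noteq> j} \<le> card (I \<times> I)"
      using assms by (intro card_mono) auto
    then show "card {(i, j). i \<in> I \<and> j \<in> I \<and> i \<noteq> j} \<le> (card I)\<^sup>2" by (simp add: power2_eq_square card_cartesian_product)
  qed simp
  finally show ?thesis .
qed

section \<open>Degree deviations in split samples\<close>

text \<open>Blue edges at the red clique and red edges at the blue clique all run between the two.
  There are at most \<open>k * k / 4\<close> such pairs, but the expected degrees ask for at least
  \<open>k * (k - 1) * (1/4 + \<epsilon>)\<close>; the deviations must cover the gap.\<close>

lemma split_deviation_lower_bound:
  fixes p :: "'a \<Rightarrow> real"
  assumes fin: "finite I" and inj: "inj_on f I" and split: "splits E (f ` I) R"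
    and sym: "\<And>i j. i \<in> I \<Longrightarrow> j \<in> I \<Longrightarrow> i \<noteq> j \<Longrightarrow> E (f i) (f j) = E (f j) (f i)"
    and p: "\<And>i. i \<in> I \<Longrightarrow> 1/4 + \<epsilon> \<le> p (f i) \<and> p (f i) \<le> 3/4 - \<epsilon>"
  defines "k \<equiv> real (card I)"
  shows "\<epsilon> * k * (k - 1) - k / 4 \<le> (\<Sum>i\<in>I. \<bar>\<Sum>j\<in>I - {i}. of_bool (E (f i) (f j)) - p (f i)\<bar>)"
proof (cases "I = {}")
  case True
  then show ?thesis by (simp add: k_def)
next
  case False
  then have k1: "k \<ge> 1" using fin by (simp add: k_def Suc_leI card_gt_0_iff)
  define y where "y i = (\<Sum>j\<in>I - {i}. of_bool (E (f i) (f j)) - p (f i))" for i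
  define A where "A = {i\<in>I. f i \<in> R}"
  define B where "B = {i\<in>I. f i \<notin> R}"
  have AB: "finite A" "finite B" "A \<union> B = I" "A \<inter> B = {}" using fin by (auto simp: A_def B_def)
  then have cardAB: "k = real (card A) + card B" unfolding k_def by (metis card_Un_disjoint of_nat_add)
  have card1: "real (card (I - {i})) = k - 1" if "i \<in> I" for i
    using that fin k1 by (simp add: k_def card_Diff_singleton of_nat_diff)
  \<comment> \<open>A position in \<open>A\<close> sees blue only towards \<open>B\<close>, while
    its expected number of blue edges is at least
    \<open>(k - 1) * (1/4 + \<epsilon>)\<close>.\<close>
  have red: "- \<bar>y i\<bar> \<le> (\<Sum>j\<in>B. of_bool (\<not> E (f i) (f j))) - (k - 1) * (1/4 + \<epsilon>)" if i: "i \<in> A" for i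
  proof -
    have iI: "i \<in> I" using i by (simp add: A_def)
    have "y i = (\<Sum>j\<in>I - {i}. (1 - p (f i)) - of_bool (\<not> E (f i) (f j)))"
      unfolding y_def by (intro sum.cong) auto
    also have "\<dots> = (k - 1) * (1 - p (f i)) - (\<Sum>j\<in>I - {i}. of_bool (\<not> E (f i) (f j)))"
      by (simp add: sum_subtractf card1[OF iI])
    also have "(\<Sum>j\<in>I - {i}. of_bool (\<not> E (f i) (f j))) = (\<Sum>j\<in>B. of_bool (\<not> E (f i) (f j)) :: real)"
    proof (rule sum.mono_neutral_right)
      show "\<forall>j\<in>I - {i} - B. of_bool (\<not> E (f i) (f j)) = (0::real)"
      proof
        fix j assume "j \<in> I - {i} - B"
        then have "E (f i) (f j)"
          using i inj split by (auto simp: A_def B_def inj_on_def intro!: splits_red[of E "f ` I" R])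
        then show "of_bool (\<not> E (f i) (f j)) = (0::real)" by simp
      qed
    qed (use fin i in \<open>auto simp: A_def B_def\<close>)
    finally have "y i = (k - 1) * (1 - p (f i)) - (\<Sum>j\<in>B. of_bool (\<not> E (f i) (f j)))" .
    moreover have "(k - 1) * (1/4 + \<epsilon>) \<le> (k - 1) * (1 - p (f i))"
      using p[OF iI] k1 by (intro mult_left_mono) auto
    ultimately show ?thesis by linarith
  qed
  have blue: "- \<bar>y i\<bar> \<le> (\<Sum>j\<in>A. of_bool (E (f i) (f j))) - (k - 1) * (1/4 + \<epsilon>)" if i: "i \<in> B" for i
  proof -
    have iI: "i \<in> I" using i by (simp add: B_def)
    have "y i = (\<Sum>j\<in>I - {i}. of_bool (E (f i) (f j))) - (k - 1) * p (f i)"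
      by (simp add: y_def sum_subtractf card1[OF iI])
    also have "(\<Sum>j\<in>I - {i}. of_bool (E (f i) (f j))) = (\<Sum>j\<in>A. of_bool (E (f i) (f j)) :: real)"
    proof (rule sum.mono_neutral_right)
      show "\<forall>j\<in>I - {i} - A. of_bool (E (f i) (f j)) = (0::real)"
      proof
        fix j assume j: "j \<in> I - {i} - A"
        have "\<not> E (f i) (f j)"
          by (rule splits_blue[OF split]) (use i j inj in \<open>auto simp: A_def B_def inj_on_def\<close>)
        then show "of_bool (E (f i) (f j)) = (0::real)" by simp
      qed
    qed (use fin i in \<open>auto simp: A_def B_def\<close>)
    finally have "y i = (\<Sum>j\<in>A. of_bool (E (f i) (f j))) - (k - 1) * p (f i)" .
    moreover have "(k - 1) * (1/4 + \<epsilon>) \<le> (k - 1) * p (f i)"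
      using p[OF iI] k1 by (intro mult_left_mono) auto
    ultimately show ?thesis by linarith
  qed
  \<comment> \<open>Each pair between \<open>A\<close> and \<open>B\<close> is counted exactly once:
    at its end in \<open>A\<close> if blue, at its end in \<open>B\<close> if red.\<close>
  have "(\<Sum>i\<in>B. \<Sum>j\<in>A. of_bool (E (f i) (f j))) = (\<Sum>i\<in>B. \<Sum>j\<in>A. of_bool (E (f j) (f i)) :: real)"
    using sym AB by (intro sum.cong refl arg_cong[of _ _ of_bool]) (auto simp: A_def B_def)
  also have "\<dots> = (\<Sum>i\<in>A. \<Sum>j\<in>B. of_bool (E (f i) (f j)))" by (rule sum.swap)
  finally have swap: "(\<Sum>i\<in>A. \<Sum>j\<in>B. of_bool (\<not> E (f i) (f j))) + (\<Sum>i\<in>B. \<Sum>j\<in>A. of_bool (E (f i) (f j)))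
      = (\<Sum>i\<in>A. \<Sum>j\<in>B. 1 :: real)"
    by (simp only: sum.distrib[symmetric]) (intro sum.cong refl, simp)
  have "- (\<Sum>i\<in>I. \<bar>y i\<bar>) = (\<Sum>i\<in>A. - \<bar>y i\<bar>) + (\<Sum>i\<in>B. - \<bar>y i\<bar>)"
    unfolding AB(3)[symmetric] sum.union_disjoint[OF AB(1,2,4)] by (simp add: sum_negf)
  also have "\<dots> \<le> (\<Sum>i\<in>A. (\<Sum>j\<in>B. of_bool (\<not> E (f i) (f j))) - (k - 1) * (1/4 + \<epsilon>))
      + (\<Sum>i\<in>B. (\<Sum>j\<in>A. of_bool (E (f i) (f j))) - (k - 1) * (1/4 + \<epsilon>))"
    using red blue by (intro add_mono sum_mono) auto
  also have "\<dots> = card A * card B - k * ((k - 1) * (1/4 + \<epsilon>))"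
    using swap unfolding sum_subtractf by (simp add: cardAB field_simps)
  finally have 1: "- (\<Sum>i\<in>I. \<bar>y i\<bar>) \<le> card A * card B - k * ((k - 1) * (1/4 + \<epsilon>))" .
  have "0 \<le> (real (card A) - real (card B))\<^sup>2" by simp
  then have "real (card A) * card B \<le> k * k / 4" by (simp add: cardAB power2_eq_square algebra_simps)
  then have "\<epsilon> * k * (k - 1) - k / 4 \<le> (\<Sum>i\<in>I. \<bar>y i\<bar>)"
  proof -
    have "k * ((k - 1) * (1/4 + \<epsilon>)) = \<epsilon> * k * (k - 1) + k * k / 4 - k / 4" by (simp add: field_simps)
    then show ?thesis using 1[unfolded of_nat_mult] \<open>real (card A) * card B \<le> k * k / 4\<close> by linarith
  qed
  then show ?thesis by (simp add: y_def)
qed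

text \<open>With \<open>s\<close> a lower bound for the mean absolute deviation,
  \<open>2 * s * \<bar>y i\<bar> \<le> (y i)\<^sup>2 + s\<^sup>2\<close> does the work of
  Cauchy-Schwarz and gives \<open>k * s\<^sup>2\<close> as the bound on the sum of squares.\<close>

lemma split_deviation_squares:
  fixes p :: "'a \<Rightarrow> real"
  assumes "finite I" "inj_on f I" "splits E (f ` I) R"
    and "\<And>i j. i \<in> I \<Longrightarrow> j \<in> I \<Longrightarrow> i \<noteq> j \<Longrightarrow> E (f i) (f j) = E (f j) (f i)"
    and "\<And>i. i \<in> I \<Longrightarrow> 1/4 + \<epsilon> \<le> p (f i) \<and> p (f i) \<le> 3/4 - \<epsilon>"
    and \<epsilon>: "0 < \<epsilon>" "\<epsilon> \<le> 1/4" "2 \<le> \<epsilon> * card I"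
  shows "\<epsilon>\<^sup>2 * real (card I) ^ 3 / 4 \<le> (\<Sum>i\<in>I. (\<Sum>j\<in>I - {i}. of_bool (E (f i) (f j)) - p (f i))\<^sup>2)"
proof -
  define k where "k = real (card I)"
  define y where "y i = (\<Sum>j\<in>I - {i}. of_bool (E (f i) (f j)) - p (f i))" for i
  define s where "s = \<epsilon> * k / 2"
  have k: "k \<ge> 0" and s: "s > 0" using \<epsilon> by (auto simp: k_def s_def)
  have "k * s \<le> \<epsilon> * k * (k - 1) - k / 4"
  proof -
    \<comment> \<open>Half of \<open>\<epsilon> * k\<close> is at least 1 and absorbs the
      lower-order terms \<open>\<epsilon> + 1/4\<close>.\<close>
    have "s \<le> \<epsilon> * (k - 1) - 1 / 4" using \<epsilon> by (simp add: s_def k_def algebra_simps)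
    then have "k * s \<le> k * (\<epsilon> * (k - 1) - 1 / 4)" using k by (rule mult_left_mono)
    then show ?thesis by (simp add: algebra_simps)
  qed
  also have "\<dots> \<le> (\<Sum>i\<in>I. \<bar>y i\<bar>)"
    unfolding y_def k_def by (rule split_deviation_lower_bound) (use assms in auto)
  finally have "2 * s * (k * s) \<le> 2 * s * (\<Sum>i\<in>I. \<bar>y i\<bar>)" using s by (intro mult_left_mono) auto
  also have "\<dots> = (\<Sum>i\<in>I. 2 * s * \<bar>y i\<bar>)" by (simp add: sum_distrib_left)
  also have "\<dots> \<le> (\<Sum>i\<in>I. (y i)\<^sup>2 + s\<^sup>2)"
  proof (rule sum_mono)
    fix i
    have "0 \<le> (\<bar>y i\<bar> - s)\<^sup>2" by simp
    then show "2 * s * \<bar>y i\<bar> \<le> (y i)\<^sup>2 + s\<^sup>2" by (simp add: power2_diff mult_ac)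
  qed
  also have "\<dots> = (\<Sum>i\<in>I. (y i)\<^sup>2) + k * s\<^sup>2" by (simp add: sum.distrib k_def)
  finally have "k * s\<^sup>2 \<le> (\<Sum>i\<in>I. (y i)\<^sup>2)" by (simp add: power2_eq_square algebra_simps)
  then show ?thesis by (simp add: y_def s_def k_def power2_eq_square power3_eq_cube algebra_simps)
qed

section \<open>Non-split samples and non-split 5-tuples\<close>

text \<open>A sample fails only by repeating a vertex or by having squared deviation at least
  \<open>T\<close>. The first affects a share of at most \<open>k\<^sup>2 / n \<le> 1/4\<close>; by
  Markov's inequality the second affects at most
  \<open>k\<^sup>2 / T = 4 / (\<epsilon>\<^sup>2 * k) \<le> 1/4\<close>.\<close>

lemma half_of_samples_nonsplit:
  assumes fin: "finite V" and sym: "\<And>u v. u \<in> V \<Longrightarrow> v \<in> V \<Longrightarrow> E u v = E v u"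
    and bal: "\<And>v. v \<in> V \<Longrightarrow> (1/4 + \<epsilon>) * card V \<le> card {u\<in>V. E v u} \<and> card {u\<in>V. E v u} \<le> (3/4 - \<epsilon>) * card V"
    and \<epsilon>: "0 < \<epsilon>" "\<epsilon> \<le> 1/4" and k: "16 \<le> \<epsilon>\<^sup>2 * k" and large: "4 * k\<^sup>2 \<le> card V"
  shows "card V ^ k \<le> 2 * card {f \<in> {..<k} \<rightarrow>\<^sub>E V. inj_on f {..<k} \<and> (\<forall>R. \<not> splits E (f ` {..<k}) R)}"
proof -
  define n where "n = card V"
  define I where "I = {..<k}"
  define P where "P = I \<rightarrow>\<^sub>E V"
  define p where "p v = real (card {u\<in>V. E v u}) / n" for v
  define D where "D f = (\<Sum>i\<in>I. (\<Sum>j\<in>I - {i}. of_bool (E (f i) (f j)) - p (f i))\<^sup>2)" for f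
  define T where "T = \<epsilon>\<^sup>2 * real k ^ 3 / 4"
  have k0: "k > 0" using k by (cases "k = 0") auto
  then have n0: "n > 0" using large by (simp add: n_def) (metis gr0I mult_is_0 not_le power_eq_0_iff zero_neq_numeral)
  have I: "finite I" "card I = k" by (auto simp: I_def)
  have finP: "finite P" and cardP: "card P = n ^ k"
    using fin I by (auto simp: P_def finite_PiE card_PiE_const n_def)
  have p: "1/4 + \<epsilon> \<le> p v \<and> p v \<le> 3/4 - \<epsilon>" if "v \<in> V" for v
    using bal[OF that] n0 by (simp add: p_def n_def field_simps)
  have "\<epsilon>\<^sup>2 * k \<le> \<epsilon> * k" using \<epsilon> by (intro mult_right_mono) (auto simp: power2_eq_square)
  then have \<epsilon>k: "2 \<le> \<epsilon> * k" using k by linarith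
  have "(\<Sum>f\<in>P. D f) = (\<Sum>i\<in>I. \<Sum>f\<in>P. (\<Sum>j\<in>I - {i}. of_bool (E (f i) (f j)) - p (f i))\<^sup>2)"
    unfolding D_def by (rule sum.swap)
  also have "\<dots> \<le> (\<Sum>i\<in>I. real (card I * card V ^ card I))"
  proof (rule sum_mono)
    fix i assume "i \<in> I"
    \<comment> \<open>Samples may repeat vertices, so the mean is taken over all of
      \<open>V\<close>, including \<open>v\<close> itself; \<open>p v\<close> is normalised by the
      same \<open>n\<close>, which makes it exactly zero.\<close>
    define \<phi> where "\<phi> v u = of_bool (E v u) - p v" for v u
    have "(\<Sum>f\<in>I \<rightarrow>\<^sub>E V. (\<Sum>j\<in>I - {i}. \<phi> (f i) (f j))\<^sup>2) \<le> card I * card V ^ card I"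
    proof (rule sum_sampled_squares_le[OF I(1) \<open>i \<in> I\<close> fin])
      show "(\<Sum>u\<in>V. \<phi> v u) = 0" for v
        using fin n0 by (simp add: \<phi>_def sum_subtractf p_def n_def Int_def)
      show "\<bar>\<phi> v u\<bar> \<le> 1" if "v \<in> V" for u v using p[OF that] \<epsilon> by (auto simp: \<phi>_def of_bool_def)
    qed
    then show "(\<Sum>f\<in>P. (\<Sum>j\<in>I - {i}. of_bool (E (f i) (f j)) - p (f i))\<^sup>2) \<le> real (card I * card V ^ card I)"
      by (simp add: \<phi>_def P_def)
  qed
  also have "\<dots> = real k ^ 2 * real n ^ k" by (simp add: I n_def power2_eq_square)
  finally have D: "(\<Sum>f\<in>P. D f) \<le> real k ^ 2 * real n ^ k" .
  define dev where "dev = {f\<in>P. T \<le> D f}"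
  define rep where "rep = {f\<in>P. \<not> inj_on f I}"
  define good where "good = {f\<in>P. inj_on f I \<and> (\<forall>R. \<not> splits E (f ` I) R)}"
  have "P \<subseteq> dev \<union> rep \<union> good"
  proof
    fix f assume f: "f \<in> P"
    show "f \<in> dev \<union> rep \<union> good"
    proof (rule ccontr)
      assume "f \<notin> dev \<union> rep \<union> good"
      then have inj: "inj_on f I" and nD: "\<not> T \<le> D f" and "\<exists>R. splits E (f ` I) R"
        using f by (auto simp: dev_def rep_def good_def)
      then obtain R where R: "splits E (f ` I) R" by blast
      have fV: "f i \<in> V" if "i \<in> I" for i using f that by (auto simp: P_def PiE_mem)
      have "\<epsilon>\<^sup>2 * real (card I) ^ 3 / 4 \<le> D f"
        unfolding D_def
      proof (rule split_deviation_squares[OF I(1) inj R])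
      qed (use fV sym p \<epsilon> \<epsilon>k I in auto)
      then show False using nD by (simp add: T_def I)
    qed
  qed
  then have "card P \<le> card (dev \<union> rep \<union> good)"
    using finP by (intro card_mono) (auto simp: dev_def rep_def good_def)
  also have "\<dots> \<le> card dev + card rep + card good"
    using card_Un_le[of "dev \<union> rep" good] card_Un_le[of dev rep] by linarith
  finally have total: "n ^ k \<le> card dev + card rep + card good" by (simp add: cardP)
  have dev: "4 * real (card dev) \<le> real n ^ k"
  proof -
    have "real (card dev) * T = (\<Sum>f\<in>dev. T)" by simp
    also have "\<dots> \<le> (\<Sum>f\<in>dev. D f)" by (intro sum_mono) (auto simp: dev_def)
    also have "\<dots> \<le> (\<Sum>f\<in>P. D f)"
      using finP by (intro sum_mono2) (auto simp: dev_def D_def sum_nonneg)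
    also note D
    finally have "real (card dev) * (\<epsilon>\<^sup>2 * k / 4) * real k ^ 2 \<le> real n ^ k * real k ^ 2"
      by (simp add: T_def power2_eq_square power3_eq_cube mult_ac)
    then have "real (card dev) * (\<epsilon>\<^sup>2 * k / 4) \<le> real n ^ k" using k0 by simp
    moreover have "real (card dev) * 4 \<le> real (card dev) * (\<epsilon>\<^sup>2 * k / 4)"
      using k by (intro mult_left_mono) auto
    ultimately show ?thesis by linarith
  qed
  have "n * card rep \<le> k\<^sup>2 * n ^ k"
    using card_noninjective_le[OF I(1) fin] by (simp add: rep_def P_def n_def I)
  moreover have "4 * k\<^sup>2 * card rep \<le> n * card rep" using large by (simp add: n_def)
  ultimately have "k\<^sup>2 * (4 * card rep) \<le> k\<^sup>2 * n ^ k" by linarith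
  then have rep: "4 * card rep \<le> n ^ k" using k0 by simp
  have "4 * card dev \<le> n ^ k" using dev by (metis of_nat_le_iff of_nat_mult of_nat_numeral of_nat_power)
  then have "n ^ k \<le> 2 * card good" using total rep by linarith
  then show ?thesis by (simp add: good_def P_def I_def n_def)
qed

text \<open>Each good sample has five positions with non-split image. Pigeonhole over
  \<open>k ^ 5\<close> position lists and \<open>2 ^ 25\<close> patterns fixes both, and each
  5-tuple arises from at most \<open>n ^ (k - 5)\<close> samples; the remaining factor 2 comes from
  \<open>good\<close>.\<close>

lemma many_nonsplit_pattern_tuples:
  assumes fin: "finite V" and sym: "\<And>u v. u \<in> V \<Longrightarrow> v \<in> V \<Longrightarrow> E u v = E v u"
    and "V \<noteq> {}" and k: "5 \<le> k"
    and good: "card V ^ k \<le> 2 * card {f \<in> {..<k} \<rightarrow>\<^sub>E V. inj_on f {..<k} \<and> (\<forall>R. \<not> splits E (f ` {..<k}) R)}"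
  shows "\<exists>\<chi> M. M \<subseteq> pattern_tuples E V 5 \<chi> \<and> (\<forall>xs\<in>M. \<forall>R. \<not> splits E (set xs) R) \<and>
     real (card V) ^ 5 / (2 ^ 26 * real k ^ 5) \<le> card M"
proof -
  define I where "I = {..<k}"
  define n where "n = card V"
  define G where "G = {f \<in> I \<rightarrow>\<^sub>E V. inj_on f I \<and> (\<forall>R. \<not> splits E (f ` I) R)}"
  have I: "finite I" "card I = k" by (auto simp: I_def)
  have n0: "n > 0" using assms by (simp add: n_def card_gt_0_iff)
  have finG: "finite G" using fin I by (simp add: G_def finite_PiE)
  have "\<exists>js. length js = 5 \<and> set js \<subseteq> I \<and> distinct js \<and> (\<forall>R. \<not> splits E (f ` set js) R)" if f: "f \<in> G" for f
  proof -
    have inj: "inj_on f I" and fV: "f ` I \<subseteq> V" using f by (auto simp: G_def)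
    have "\<exists>T. T \<subseteq> f ` I \<and> card T \<le> 5 \<and> (\<forall>R. \<not> splits E T R)"
    proof (rule ccontr)
      assume "\<not> ?thesis"
      then have small: "\<exists>R. splits E T R" if "T \<subseteq> f ` I" "card T \<le> 5" for T using that by blast
      have "\<exists>R. splits E (f ` I) R"
      proof (rule foldes_hammer)
        show "E u v = E v u" if "u \<in> f ` I" "v \<in> f ` I" for u v using that fV by (intro sym) auto
      qed (use I small in auto)
      then show False using f by (simp add: G_def)
    qed
    then obtain T where T: "T \<subseteq> f ` I" "card T \<le> 5" "\<And>R. \<not> splits E T R" by blast
    obtain J where J: "J \<subseteq> I" "T = f ` J" using T(1) by (auto simp: subset_image_iff)
    have "card J \<le> 5" using T(2) J inj by (metis card_image inj_on_subset)
    \<comment> \<open>Padding to exactly five positions is harmless, since supersets of a non-split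
      set are not split.\<close>
    then obtain J' where J': "J \<subseteq> J'" "J' \<subseteq> I" "card J' = 5"
      using exists_subset_between[of J 5 I] J I k by auto
    obtain js where js: "set js = J'" "distinct js"
      using finite_distinct_list[of J'] J'(2) I(1) finite_subset by blast
    have "length js = 5" using js J'(3) distinct_card by metis
    moreover have "\<not> splits E (f ` J') R" for R
      using T(3) splits_mono[of E "f ` J'" R T] J J' by blast
    ultimately show ?thesis using js J' by blast
  qed
  then obtain js where js: "\<And>f. f \<in> G \<Longrightarrow> length (js f) = 5" "\<And>f. f \<in> G \<Longrightarrow> set (js f) \<subseteq> I"
    "\<And>f. f \<in> G \<Longrightarrow> distinct (js f)" "\<And>f R. f \<in> G \<Longrightarrow> \<not> splits E (f ` set (js f)) R" by metis
  define \<chi> where "\<chi> f = {(i, j) \<in> {..<5} \<times> {..<5}. E (f (js f ! i)) (f (js f ! j))}" for f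
  define B where "B = {xs. set xs \<subseteq> I \<and> length xs = 5} \<times> Pow ({..<5::nat} \<times> {..<5::nat})"
  have cardB: "finite B" "card B = k ^ 5 * 2 ^ 25"
    using I by (simp_all add: B_def finite_lists_length_eq card_lists_length_eq card_cartesian_product card_Pow)
  then have "B \<noteq> {}" using k by auto
  obtain ks \<psi> where F: "real (card G) / card B \<le> card {f\<in>G. (js f, \<chi> f) = (ks, \<psi>)}" "(ks, \<psi>) \<in> B"
    using large_fibre[OF finG cardB(1), of "\<lambda>f. (js f, \<chi> f)"] \<open>B \<noteq> {}\<close> js by (auto simp: B_def \<chi>_def)
  define F where "F = {f\<in>G. (js f, \<chi> f) = (ks, \<psi>)}"
  define M where "M = (\<lambda>f. map f ks) ` F"
  have finM: "finite M" using finG by (simp add: M_def F_def)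
  have M: "M \<subseteq> pattern_tuples E V 5 \<psi>"
  proof
    fix xs assume "xs \<in> M"
    then obtain f where f: "f \<in> G" "js f = ks" "\<chi> f = \<psi>" "xs = map f ks" by (auto simp: M_def F_def)
    have "length ks = 5" "set ks \<subseteq> I" "distinct ks" "inj_on f I" "f ` I \<subseteq> V"
      using js(1-3)[OF f(1)] f by (auto simp: G_def)
    moreover from this have "distinct (map f ks)" by (simp add: distinct_map inj_on_subset)
    moreover from calculation have "set (map f ks) \<subseteq> V" by auto
    ultimately show "xs \<in> pattern_tuples E V 5 \<psi>"
      using f(2,3) unfolding pattern_tuples_def f(4) by (auto simp: \<chi>_def distinct_conv_nth)
  qed
  have nonsplit: "\<not> splits E (set xs) R" if "xs \<in> M" for xs R using that js(4) by (auto simp: M_def F_def)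
  have "card F \<le> card M * n ^ (k - 5)"
  proof (cases "F = {}")
    case False
    then obtain f0 where "f0 \<in> G" "js f0 = ks" by (auto simp: F_def)
    then have ks: "length ks = 5" "set ks \<subseteq> I" "distinct ks" using js(1-3)[of f0] by auto
    then have "card (I - set ks) = k - 5" using I by (simp add: card_Diff_subset distinct_card)
    \<comment> \<open>A sample is determined by its values on \<open>ks\<close> together with its
      values at the other \<open>k - 5\<close> positions.\<close>
    have "inj_on (\<lambda>f. (map f ks, restrict f (I - set ks))) F"
    proof (rule inj_onI)
      fix f g assume fg: "f \<in> F" "g \<in> F"
        "(map f ks, restrict f (I - set ks)) = (map g ks, restrict g (I - set ks))"
      have "f \<in> I \<rightarrow>\<^sub>E V" "g \<in> I \<rightarrow>\<^sub>E V" using fg by (auto simp: F_def G_def)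
      moreover have "f i = g i" if "i \<in> I" for i
        using fg(3) that by (cases "i \<in> set ks") (auto simp: fun_eq_iff restrict_def split: if_splits)
      ultimately show "f = g" by (rule PiE_ext)
    qed
    moreover have "(\<lambda>f. (map f ks, restrict f (I - set ks))) ` F \<subseteq> M \<times> ((I - set ks) \<rightarrow>\<^sub>E V)"
      by (auto simp: M_def F_def G_def)
    ultimately have "card F \<le> card (M \<times> ((I - set ks) \<rightarrow>\<^sub>E V))"
      using finM fin I by (intro card_inj_on_le) (auto simp: finite_PiE)
    also have "\<dots> = card M * n ^ (k - 5)"
      using I \<open>card (I - set ks) = k - 5\<close> by (simp add: card_cartesian_product card_PiE_const n_def)
    finally show ?thesis .
  qed simp
  then have "real (card F) \<le> real (card M * n ^ (k - 5))" by (rule of_nat_mono)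
  then have "real (card F) \<le> card M * real n ^ (k - 5)" by simp
  moreover have "real n ^ k \<le> 2 * card G"
    using of_nat_mono[OF good, where ?'a = real] by (simp add: G_def I_def n_def)
  then have "real n ^ k / 2 / card B \<le> real (card G) / card B" by (intro divide_right_mono) auto
  ultimately have "real n ^ k / 2 / card B \<le> card M * real n ^ (k - 5)" using F(1) unfolding F_def by linarith
  moreover have "real n ^ k = real n ^ 5 * real n ^ (k - 5)" using k by (simp flip: power_add)
  ultimately have "real n ^ 5 / 2 / card B * real n ^ (k - 5) \<le> card M * real n ^ (k - 5)" by simp
  then have "real n ^ 5 / 2 / card B \<le> card M" by (rule mult_right_le_imp_le) (use n0 in simp)
  then show ?thesis using M nonsplit by (auto simp: cardB n_def mult_ac intro!: exI[of _ \<psi>] exI[of _ M])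
qed

section \<open>Combination of sampling and blow-up\<close>

lemma alternating_pair_exists:
  assumes fin: "finite V" and sym: "\<And>u v. u \<in> V \<Longrightarrow> v \<in> V \<Longrightarrow> E u v = E v u"
    and bal: "\<And>v. v \<in> V \<Longrightarrow> (1/4 + \<epsilon>) * card V \<le> card {u\<in>V. E v u} \<and> card {u\<in>V. E v u} \<le> (3/4 - \<epsilon>) * card V"
    and \<epsilon>: "0 < \<epsilon>" "\<epsilon> \<le> 1/4" and k: "16 \<le> \<epsilon>\<^sup>2 * k" and t: "1 \<le> t"
    and large: "2 ^ 32 * k ^ 5 * 8 ^ (t * 2 ^ 160 * k ^ 25) \<le> card V"
  shows "\<exists>A B c. A \<subseteq> V \<and> B \<subseteq> V \<and> A \<inter> B = {} \<and> card A = t \<and> card B = t \<and>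
     mono_set E c A \<and> mono_set E c B \<and> (\<forall>u\<in>A. \<forall>v\<in>B. E u v = (\<not> c))"
proof -
  have "\<epsilon>\<^sup>2 * k \<le> 1 * real k" using \<epsilon> by (intro mult_right_mono) (auto simp: power_le_one)
  then have k16: "16 \<le> k" using k by linarith
  \<comment> \<open>The blow-up with five parts keeps a share
    \<open>(c / 2 ^ 6) ^ 5 = 1 / (2 ^ 160 * k ^ 25)\<close> of \<open>m\<close>, so this
    \<open>m\<close> leaves exactly \<open>t\<close>.\<close>
  define m where "m = t * 2 ^ 160 * k ^ 25"
  define c where "c = 1 / (2 ^ 26 * real k ^ 5)"
  have "4 * k\<^sup>2 \<le> 2 ^ 32 * k ^ 5 * 8 ^ m"
  proof -
    have "4 * k\<^sup>2 \<le> 2 ^ 32 * k ^ 5" using k16 by (intro mult_mono power_increasing) auto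
    also have "\<dots> \<le> 2 ^ 32 * k ^ 5 * 8 ^ m" by simp
    finally show ?thesis .
  qed
  then have "4 * k\<^sup>2 \<le> card V" using large unfolding m_def by (rule order_trans)
  then have half: "card V ^ k \<le> 2 * card {f \<in> {..<k} \<rightarrow>\<^sub>E V. inj_on f {..<k} \<and> (\<forall>R. \<not> splits E (f ` {..<k}) R)}"
    using half_of_samples_nonsplit[OF fin _ _ \<epsilon> k] sym bal by simp
  have "V \<noteq> {}" using \<open>4 * k\<^sup>2 \<le> card V\<close> k16 by auto
  have "5 \<le> k" using k16 by simp
  obtain \<chi> M where M: "M \<subseteq> pattern_tuples E V 5 \<chi>" "\<And>xs R. xs \<in> M \<Longrightarrow> \<not> splits E (set xs) R"
     "real (card V) ^ 5 / (2 ^ 26 * real k ^ 5) \<le> card M"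
    using many_nonsplit_pattern_tuples[OF fin sym \<open>V \<noteq> {}\<close> \<open>5 \<le> k\<close> half] by blast
  have c: "0 < c" "c * card V ^ 5 \<le> card M" using M(3) k16 by (auto simp: c_def)
  have c6: "c / 2 ^ Suc 5 = 1 / (2 ^ 32 * real k ^ 5)" by (simp add: c_def)
  have "2 ^ 32 * real k ^ 5 * 8 ^ m \<le> card V"
    using of_nat_mono[OF large, where ?'a = real] by (simp add: m_def)
  then have "8 ^ m \<le> c / 2 ^ Suc 5 * card V" using k16 unfolding c6 by (simp add: field_simps)
  moreover have "0 < m" using t k16 by (simp add: m_def)
  ultimately obtain L w where L: "finite L" "w ` L \<subseteq> M" "mono_blowup E 5 \<chi> L w"
    "(c / 2 ^ Suc 5) ^ 5 * m \<le> card L"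
    using mono_blowup_exists[OF fin _ c(1) M(1) c(2), of m] sym by auto
  have "(c / 2 ^ Suc 5) ^ 5 * m = t"
    using k16 unfolding c6 m_def by (simp add: power_divide power_mult_distrib flip: power_mult)
  then have tL: "t \<le> card L" using L(4) by simp
  then have "L \<noteq> {}" using t by auto
  have "\<exists>A B c. A \<subseteq> V \<and> B \<subseteq> V \<and> A \<inter> B = {} \<and> card A = card L \<and> card B = card L \<and>
     mono_set E c A \<and> mono_set E c B \<and> (\<forall>u\<in>A. \<forall>v\<in>B. E u v = (\<not> c))"
    by (rule alternating_pair_from_blowup[OF _ M(1,2) L(2,3) \<open>L \<noteq> {}\<close>]) (simp_all add: sym)
  then obtain A B c where AB: "A \<subseteq> V" "B \<subseteq> V" "A \<inter> B = {}" "card A = card L" "card B = card L"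
     "mono_set E c A" "mono_set E c B" "\<forall>u\<in>A. \<forall>v\<in>B. E u v = (\<not> c)"
    by (elim exE conjE) (rule that)
  obtain A' where A': "A' \<subseteq> A" "card A' = t" using tL AB(4) obtain_subset_with_card_n by metis
  obtain B' where B': "B' \<subseteq> B" "card B' = t" using tL AB(5) obtain_subset_with_card_n by metis
  show ?thesis
  proof (intro exI conjI)
    show "A' \<subseteq> V" "B' \<subseteq> V" "A' \<inter> B' = {}" using AB(1-3) A'(1) B'(1) by auto
    show "mono_set E c A'" "mono_set E c B'" using AB(6,7) A'(1) B'(1) unfolding mono_set_def by blast+
    show "\<forall>u\<in>A'. \<forall>v\<in>B'. E u v = (\<not> c)" using AB(8) A'(1) B'(1) by blast
  qed fact+
qed

section \<open>The numerical threshold\<close>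

text \<open>With \<open>x = log 2 (1/\<epsilon>)\<close>, a suitable \<open>k\<close> is at most
  \<open>2 powr (5 * x)\<close>, so the exponent of the required size is \<open>t\<close> times 2 to
  a linear function of \<open>x\<close>. As \<open>x \<ge> 2\<close>, that function is below
  \<open>300 * x ^ 8\<close>.\<close>

lemma threshold_bound:
  fixes \<epsilon> :: real and t :: nat
  assumes \<epsilon>: "0 < \<epsilon>" "\<epsilon> < 1/4" and t: "1 \<le> t"
  shows "\<exists>k::nat. 16 \<le> \<epsilon>\<^sup>2 * k \<and>
    real (2 ^ 32 * k ^ 5 * 8 ^ (t * 2 ^ 160 * k ^ 25)) \<le> 2 powr (t * 2 powr (300 * log 2 (1/\<epsilon>) ^ 8))"
proof -
  define x where "x = log 2 (1/\<epsilon>)"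
  have px: "2 powr x = 1/\<epsilon>" using \<epsilon> by (simp add: x_def)
  have "2 powr 2 \<le> 2 powr x" unfolding px using \<epsilon> by (simp add: field_simps)
  then have x: "2 \<le> x" by (simp only: powr_le_cancel_iff one_less_numeral_iff semiring_norm)
  define k where "k = nat \<lceil>16 / \<epsilon>\<^sup>2\<rceil>"
  have k1: "16 / \<epsilon>\<^sup>2 \<le> k" and k2: "k \<le> 16 / \<epsilon>\<^sup>2 + 1" by (auto simp: k_def)
  have "1 \<le> 16 / \<epsilon>\<^sup>2" using \<epsilon> power_mono[of \<epsilon> 1 2] by (simp add: field_simps)
  then have "k \<le> 32 / \<epsilon>\<^sup>2" using k2 by simp
  also have "\<dots> = 2 powr 5 * (2 powr x) powr 2" using \<epsilon> by (simp add: px powr_numeral power_divide)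
  also have "\<dots> = 2 powr (5 + 2 * x)" by (simp add: powr_add powr_powr mult.commute)
  also have "\<dots> \<le> 2 powr (5 * x)" using x by (intro powr_mono) auto
  finally have k: "real k \<le> 2 powr (5 * x)" .
  have k0: "0 < real k" using k1 \<open>1 \<le> 16 / \<epsilon>\<^sup>2\<close> by linarith
  have "real k ^ 25 \<le> (2 powr (5 * x)) ^ 25" using k by (intro power_mono) auto
  also have "\<dots> = 2 powr (125 * x)" by (simp add: powr_power)
  finally have k25: "real k ^ 25 \<le> 2 powr (125 * x)" .
  have "3 * (t * 2 ^ 160 * real k ^ 25) \<le> 2 powr 2 * (t * 2 powr 160 * 2 powr (125 * x))"
    using k25 by (intro mult_mono) auto
  also have "\<dots> = t * 2 powr (162 + 125 * x)" by (simp add: powr_add)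
  \<comment> \<open>Here \<open>162 \<le> 81 * x\<close> because \<open>x \<ge> 2\<close>, and
    \<open>206 = 125 + 81\<close>.\<close>
  also have "\<dots> \<le> t * 2 powr (206 * x)" using x by (intro mult_left_mono powr_mono) auto
  finally have main: "3 * (t * 2 ^ 160 * real k ^ 25) \<le> t * 2 powr (206 * x)" .
  have "32 + 25 * x \<le> 41 * x" using x by simp
  also have "\<dots> \<le> t * 2 powr (206 * x)"
  proof -
    have "41 * x \<le> 206 * x * (1/2)" using x by simp
    also have "206 * x * (1/2) \<le> 1 * 2 powr (206 * x)"
    proof -
      have "1/2 \<le> ln (2::real)" using ln_le_minus_one[of "1/2 :: real"] by (simp add: ln_div)
      then have "206 * x * (1/2) \<le> 206 * x * ln 2" using x by (intro mult_left_mono) auto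
      also have "\<dots> \<le> exp (206 * x * ln 2)"
        using exp_ge_add_one_self[of "206 * x * ln 2"] by linarith
      also have "\<dots> = 2 powr (206 * x)" by (simp add: powr_def)
      finally show ?thesis by simp
    qed
    also have "\<dots> \<le> t * 2 powr (206 * x)" using t by (intro mult_right_mono) auto
    finally show ?thesis .
  qed
  \<comment> \<open>Both summands lie below \<open>t * 2 powr (206 * x)\<close>, whence the factor
    \<open>2 powr 1\<close>.\<close>
  finally have "32 + 25 * x + 3 * (t * 2 ^ 160 * real k ^ 25) \<le> t * (2 powr 1 * 2 powr (206 * x))" using main by simp
  also have "\<dots> = t * 2 powr (1 + 206 * x)" by (simp add: powr_add)
  also have "\<dots> \<le> t * 2 powr (300 * x ^ 8)"
  proof (intro mult_left_mono powr_mono)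
    have "x \<le> x ^ 8" using x self_le_power[of x 8] by simp
    then show "1 + 206 * x \<le> 300 * x ^ 8" using x by linarith
  qed auto
  finally have expo: "32 + 25 * x + 3 * (t * 2 ^ 160 * real k ^ 25) \<le> t * 2 powr (300 * x ^ 8)" .
  have "real (2 ^ 32 * k ^ 5 * 8 ^ (t * 2 ^ 160 * k ^ 25)) = 2 ^ 32 * real k ^ 5 * 8 powr (t * 2 ^ 160 * real k ^ 25)"
    by (simp add: powr_realpow[symmetric])
  also have "\<dots> \<le> 2 powr 32 * (2 powr (5 * x)) ^ 5 * (2 powr 3) powr (t * 2 ^ 160 * real k ^ 25)"
    using k by (intro mult_mono power_mono) auto
  also have "\<dots> = 2 powr (32 + 25 * x + 3 * (t * 2 ^ 160 * real k ^ 25))"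
    by (simp only: powr_add powr_powr powr_power) (simp add: powr_power powr_powr)
  also have "\<dots> \<le> 2 powr (t * 2 powr (300 * x ^ 8))" using expo by (intro powr_mono) auto
  finally have "real (2 ^ 32 * k ^ 5 * 8 ^ (t * 2 ^ 160 * k ^ 25)) \<le> 2 powr (t * 2 powr (300 * x ^ 8))" .
  moreover have "16 \<le> \<epsilon>\<^sup>2 * k" using k1 \<epsilon> by (simp add: field_simps)
  ultimately show ?thesis unfolding x_def by blast
qed

section \<open>Passage from locally balanced colourings\<close>

theorem theorem1p3:
  "\<exists>C::real. C > 0 \<and>
     (\<forall>(\<epsilon>::real) (t::nat) (n::nat) (col :: nat \<Rightarrow> nat \<Rightarrow> bool).
        0 < \<epsilon> \<and> \<epsilon> < 1/4 \<and> t \<ge> 1 \<and>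
        real n \<ge> 2 powr (real t * 2 powr (C * (log 2 (1/\<epsilon>)) ^ 8)) \<and>
        two_colouring n col \<and> locally_balanced n col (1/4 + \<epsilon>) \<longrightarrow>
        (\<exists>A B c. A \<subseteq> {..<n} \<and> B \<subseteq> {..<n} \<and> A \<inter> B = {} \<and>
           card A = t \<and> card B = t \<and>
           (\<forall>u\<in>A. \<forall>v\<in>A. u \<noteq> v \<longrightarrow> col u v = c) \<and>
           (\<forall>u\<in>B. \<forall>v\<in>B. u \<noteq> v \<longrightarrow> col u v = c) \<and>
           (\<forall>u\<in>A. \<forall>v\<in>B. col u v = (\<not> c))))"
proof (intro exI[of _ 300] conjI allI impI)
  fix \<epsilon> :: real and t n :: nat and col :: "nat \<Rightarrow> nat \<Rightarrow> bool"
  assume *: "0 < \<epsilon> \<and> \<epsilon> < 1/4 \<and> t \<ge> 1 \<and>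
        real n \<ge> 2 powr (real t * 2 powr (300 * (log 2 (1/\<epsilon>)) ^ 8)) \<and>
        two_colouring n col \<and> locally_balanced n col (1/4 + \<epsilon>)"
  then obtain k :: nat where k: "16 \<le> \<epsilon>\<^sup>2 * k"
    "real (2 ^ 32 * k ^ 5 * 8 ^ (t * 2 ^ 160 * k ^ 25)) \<le> 2 powr (t * 2 powr (300 * log 2 (1/\<epsilon>) ^ 8))"
    using threshold_bound[of \<epsilon> t] by blast
  \<comment> \<open>The diagonal of \<open>col\<close> is arbitrary. Setting it to false makes red
    neighbourhoods exclude the vertex itself, as in the definition of local balance.\<close>
  define E where "E u v \<longleftrightarrow> u \<noteq> v \<and> col u v" for u v
  have balanced: "(1/4 + \<epsilon>) * card {..<n} \<le> card {u\<in>{..<n}. E v u} \<and>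
      card {u\<in>{..<n}. E v u} \<le> (3/4 - \<epsilon>) * card {..<n}" if v: "v \<in> {..<n}" for v
  proof -
    define red where "red = {u. u < n \<and> u \<noteq> v \<and> col v u}"
    define blue where "blue = {u. u < n \<and> u \<noteq> v \<and> \<not> col v u}"
    have fin: "finite red" "finite blue" by (auto simp: red_def blue_def)
    \<comment> \<open>The lower bound on the blue degree becomes the upper bound
      \<open>3/4 - \<epsilon>\<close> on the red density.\<close>
    have "card (red \<union> blue) \<le> card {..<n}" by (intro card_mono) (auto simp: red_def blue_def)
    then have "card red + card blue \<le> n"
      using card_Un_disjoint[OF fin] by (simp add: red_def blue_def disjoint_iff)
    moreover have "(1/4 + \<epsilon>) * n \<le> card red" "(1/4 + \<epsilon>) * n \<le> card blue"
      using * v by (auto simp: locally_balanced_def red_def blue_def)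
    moreover have "{u\<in>{..<n}. E v u} = red" by (auto simp: E_def red_def)
    ultimately show ?thesis by (simp add: algebra_simps)
  qed
  have sym: "E u v = E v u" if "u \<in> {..<n}" "v \<in> {..<n}" for u v
    using * that by (auto simp: two_colouring_def E_def)
  have "real (2 ^ 32 * k ^ 5 * 8 ^ (t * 2 ^ 160 * k ^ 25)) \<le> real n" using k(2) * by linarith
  then have large: "2 ^ 32 * k ^ 5 * 8 ^ (t * 2 ^ 160 * k ^ 25) \<le> card {..<n}"
    unfolding of_nat_le_iff card_lessThan .
  have "\<exists>A B c. A \<subseteq> {..<n} \<and> B \<subseteq> {..<n} \<and> A \<inter> B = {} \<and> card A = t \<and> card B = t \<and>
     mono_set E c A \<and> mono_set E c B \<and> (\<forall>u\<in>A. \<forall>v\<in>B. E u v = (\<not> c))"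
    by (rule alternating_pair_exists[OF _ _ _ _ _ k(1) _ large])
       (use * balanced in \<open>simp_all add: sym\<close>)
  then obtain A B c where AB: "A \<subseteq> {..<n}" "B \<subseteq> {..<n}" "A \<inter> B = {}" "card A = t" "card B = t"
    "mono_set E c A" "mono_set E c B" "\<forall>u\<in>A. \<forall>v\<in>B. E u v = (\<not> c)"
    by (elim exE conjE) (rule that)
  have "\<forall>u\<in>A. \<forall>v\<in>A. u \<noteq> v \<longrightarrow> col u v = c" "\<forall>u\<in>B. \<forall>v\<in>B. u \<noteq> v \<longrightarrow> col u v = c"
    using AB(6,7) by (simp_all add: mono_set_def E_def)
  moreover have "\<forall>u\<in>A. \<forall>v\<in>B. col u v = (\<not> c)"
  proof (intro ballI)
    fix u v assume uv: "u \<in> A" "v \<in> B"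
    then have "u \<noteq> v" using AB(3) by blast
    then show "col u v = (\<not> c)" using AB(8)[rule_format, OF uv] by (simp add: E_def)
  qed
  ultimately show "\<exists>A B c. A \<subseteq> {..<n} \<and> B \<subseteq> {..<n} \<and> A \<inter> B = {} \<and>
           card A = t \<and> card B = t \<and>
           (\<forall>u\<in>A. \<forall>v\<in>A. u \<noteq> v \<longrightarrow> col u v = c) \<and>
           (\<forall>u\<in>B. \<forall>v\<in>B. u \<noteq> v \<longrightarrow> col u v = c) \<and>
           (\<forall>u\<in>A. \<forall>v\<in>B. col u v = (\<not> c))"
    using AB(1-5) by (intro exI[of _ A] exI[of _ B] exI[of _ c] conjI)
qed simp

end
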